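(* Let $L>0$ be fixed. The equation $$-\varphi''+\omega\varphi-(\kappa+\gamma B^3)\varphi^5=0$$ admits $L$-periodic solutions with a cnoidal profile of the form $$\varphi(x)=\frac{1}{\sqrt[4]{\kappa+\gamma B^3}}\,\frac{a\,\mathrm{cn}\left(\frac{4\mathrm{K}(k)}{L}x,k\right)}{\sqrt{1-q\,\mathrm{sn}^2\left(\frac{4\mathrm{K}(k)}{L}x,k\right)}},$$ where the parameters $a\in\left(2\sqrt{\tfrac{\pi}{L}},+\infty\right)$, $q\in(-2,-1)$ and the frequency $\omega\in\left(\frac{4\pi^2}{L^2},+\infty\right)$ depend smoothly on $k\in(0,1)$ and $L>0$ and are given by $$a=\frac{2}{L}\left[\left(2-k^2+2\sqrt{k^4-k^2+1}\right)L^2\mathrm{K}(k)^2\right]^{1/4},\quad q=-1+k^2-\sqrt{k^4-k^2+1},\quad \omega=\frac{16\mathrm{K}(k)^2\sqrt{k^4-k^2+1}}{L^2}.$$ In addition, the mapping $$\omega\in\left(\tfrac{4\pi^2}{L^2},+\infty\right)\longmapsto\varphi_\omega=\varphi\in H^2_{\rm per}$$ is a smooth curve of periodic solutions of the equation.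
   Context: $\kappa>0$ and $\gamma\ge0$ are real constants, and $B\in\mathbb{R}$ is one of the solutions $B=\frac{\gamma\pm\sqrt{\gamma^2-4\kappa^2}}{2\kappa}$ (considered for $\gamma>2\kappa$), $B=1$, or $B=-1$ (considered for $0\le\gamma<\kappa$) of $\kappa+\gamma B^3=\kappa B^4+\gamma B$; in all these cases $\kappa+\gamma B^3>0$. The constants $\kappa,\gamma,B$ are fixed. $\mathrm{sn}(\cdot,k)$ and $\mathrm{cn}(\cdot,k)$ are the Jacobi elliptic functions of modulus $k\in(0,1)$ and $\mathrm{K}(k)$ is the complete elliptic integral of the first kind. $H^2_{\rm per}$ is the Sobolev space of $L$-periodic functions. In the smooth curve, $\varphi_\omega$ is the cnoidal function whose modulus $k\in(0,1)$ corresponds to $\omega$ through the stated relation between $\omega$ and $k$. *)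

theory Defs
  imports "HOL-Analysis.Analysis"
begin

section \<open>Jacobi elliptic functions\<close>

text \<open>
  The argument \<open>k\<close> is always the modulus, not the parameter \<open>m = k\<^sup>2\<close>.
  The interval integral is oriented, so \<open>elliptic_F\<close> is odd in the amplitude, and for
  \<open>0 < k < 1\<close> it is an increasing bijection of the real line, with inverse \<open>jacobi_am\<close>.
\<close>

definition elliptic_F :: "real \<Rightarrow> real \<Rightarrow> real" where
  "elliptic_F \<theta> k = (LBINT t=0..\<theta>. 1 / sqrt (1 - k\<^sup>2 * (sin t)\<^sup>2))"

definition elliptic_K :: "real \<Rightarrow> real" where
  "elliptic_K k = elliptic_F (pi / 2) k"

definition jacobi_am :: "real \<Rightarrow> real \<Rightarrow> real" where
  "jacobi_am u k = (THE \<theta>. elliptic_F \<theta> k = u)"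

definition jacobi_sn :: "real \<Rightarrow> real \<Rightarrow> real" where
  "jacobi_sn u k = sin (jacobi_am u k)"

definition jacobi_cn :: "real \<Rightarrow> real \<Rightarrow> real" where
  "jacobi_cn u k = cos (jacobi_am u k)"


section \<open>Smooth functions on open sets\<close>

text \<open>
  \<open>C_diff_on n f S\<close> says that all iterated directional derivatives of \<open>f\<close> of order at most \<open>n\<close>
  exist and are continuous on the open set \<open>S\<close>, with Frechet differentiability at each stage; for
  a finite-dimensional domain and open \<open>S\<close> this is the class \<open>C\<^sup>n\<close>.
\<close>

primrec C_diff_on ::
  "nat \<Rightarrow> ('a::real_normed_vector \<Rightarrow> 'b::real_normed_vector) \<Rightarrow> 'a set \<Rightarrow> bool" where
  "C_diff_on 0 f S \<longleftrightarrow> continuous_on S f"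
| "C_diff_on (Suc n) f S \<longleftrightarrow>
     (\<forall>x\<in>S. f differentiable (at x)) \<and>
     (\<forall>v. C_diff_on n (\<lambda>x. frechet_derivative f (at x) v) S)"

definition C_infinity_on ::
  "('a::real_normed_vector \<Rightarrow> 'b::real_normed_vector) \<Rightarrow> 'a set \<Rightarrow> bool" where
  "C_infinity_on f S \<longleftrightarrow> (\<forall>n. C_diff_on n f S)"


section \<open>Periodic Sobolev spaces\<close>

text \<open>
  \<open>Hs_per L s\<close> is the space of real \<open>L\<close>-periodic functions \<open>f\<close> in \<open>L\<^sup>2(0,L)\<close> for which
  \<open>\<Sum>\<^sub>n (1 + n\<^sup>2)\<^sup>s |f\<^sub>n|\<^sup>2\<close> is finite, where \<open>f\<^sub>n\<close> are the Fourier coefficients. Its elements are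
  functions and not classes modulo null sets, so \<open>Hs_norm\<close> is a seminorm on it, which vanishes
  exactly on the functions that are zero almost everywhere.
\<close>

definition periodic :: "real \<Rightarrow> (real \<Rightarrow> 'a) \<Rightarrow> bool" where
  "periodic L f \<longleftrightarrow> (\<forall>x. f (x + L) = f x)"

definition fourier_coeff :: "real \<Rightarrow> (real \<Rightarrow> real) \<Rightarrow> int \<Rightarrow> complex" where
  "fourier_coeff L f n =
     (1 / of_real L) * (LINT x:{0..L}|lebesgue. of_real (f x) * cis (- 2 * pi * of_int n * x / L))"

definition Hs_per :: "real \<Rightarrow> nat \<Rightarrow> (real \<Rightarrow> real) set" where
  "Hs_per L s = {f. periodic L f
     \<and> f \<in> borel_measurable lebesgue
     \<and> set_integrable lebesgue {0..L} (\<lambda>x. (f x)\<^sup>2)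
     \<and> (\<lambda>n. (1 + (of_int n)\<^sup>2) ^ s * (norm (fourier_coeff L f n))\<^sup>2) summable_on UNIV}"

definition Hs_norm :: "real \<Rightarrow> nat \<Rightarrow> (real \<Rightarrow> real) \<Rightarrow> real" where
  "Hs_norm L s f =
     sqrt (L * (\<Sum>\<^sub>\<infinity>n\<in>UNIV. (1 + (of_int n)\<^sup>2) ^ s * (norm (fourier_coeff L f n))\<^sup>2))"

text \<open>
  The space depends on the number \<open>L\<close> and so is not a type; the derivative of a curve in it
  is the limit of difference quotients in \<open>Hs_norm\<close>. In \<open>smooth_Hs_curve_on\<close>, \<open>D n\<close> is
  the \<open>n\<close>-th derivative of the curve \<open>c\<close>, and \<open>I\<close> is meant to be open.
\<close>

definition has_Hs_derivative ::
  "real \<Rightarrow> nat \<Rightarrow> (real \<Rightarrow> real \<Rightarrow> real) \<Rightarrow> (real \<Rightarrow> real) \<Rightarrow> real \<Rightarrow> bool" where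
  "has_Hs_derivative L s c v t \<longleftrightarrow>
     ((\<lambda>h. Hs_norm L s (\<lambda>x. (c (t + h) x - c t x) / h - v x)) \<longlongrightarrow> 0) (at 0)"

definition smooth_Hs_curve_on ::
  "real \<Rightarrow> nat \<Rightarrow> (real \<Rightarrow> real \<Rightarrow> real) \<Rightarrow> real set \<Rightarrow> bool" where
  "smooth_Hs_curve_on L s c I \<longleftrightarrow>
     (\<exists>D :: nat \<Rightarrow> real \<Rightarrow> real \<Rightarrow> real.
        (\<forall>t\<in>I. D 0 t = c t) \<and>
        (\<forall>n. \<forall>t\<in>I. D n t \<in> Hs_per L s \<and> has_Hs_derivative L s (D n) (D (Suc n) t) t))"


section \<open>The equation and its cnoidal waves\<close>

definition admissible_B :: "real \<Rightarrow> real \<Rightarrow> real \<Rightarrow> bool" where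
  "admissible_B \<kappa> \<gamma> B \<longleftrightarrow>
     (\<gamma> > 2 * \<kappa> \<and> (B = (\<gamma> + sqrt (\<gamma>\<^sup>2 - 4 * \<kappa>\<^sup>2)) / (2 * \<kappa>) \<or>
                  B = (\<gamma> - sqrt (\<gamma>\<^sup>2 - 4 * \<kappa>\<^sup>2)) / (2 * \<kappa>)))
     \<or> B = 1
     \<or> (B = -1 \<and> \<gamma> < \<kappa>)"

definition solves_wave_eq :: "real \<Rightarrow> real \<Rightarrow> real \<Rightarrow> real \<Rightarrow> (real \<Rightarrow> real) \<Rightarrow> bool" where
  "solves_wave_eq \<kappa> \<gamma> B \<omega> \<phi> \<longleftrightarrow>
     (\<exists>\<phi>' \<phi>''. (\<forall>x. (\<phi> has_real_derivative \<phi>' x) (at x)) \<and>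
                (\<forall>x. (\<phi>' has_real_derivative \<phi>'' x) (at x)) \<and>
                (\<forall>x. - \<phi>'' x + \<omega> * \<phi> x - (\<kappa> + \<gamma> * B ^ 3) * (\<phi> x) ^ 5 = 0))"

definition cnoidal_profile ::
  "real \<Rightarrow> real \<Rightarrow> real \<Rightarrow> real \<Rightarrow> real \<Rightarrow> real \<Rightarrow> real \<Rightarrow> real \<Rightarrow> real" where
  "cnoidal_profile \<kappa> \<gamma> B L a q k x =
     1 / root 4 (\<kappa> + \<gamma> * B ^ 3) *
     (a * jacobi_cn (4 * elliptic_K k / L * x) k
        / sqrt (1 - q * (jacobi_sn (4 * elliptic_K k / L * x) k)\<^sup>2))"

definition wave_a :: "real \<Rightarrow> real \<Rightarrow> real" where
  "wave_a L k =
     2 / L * root 4 ((2 - k\<^sup>2 + 2 * sqrt (k ^ 4 - k\<^sup>2 + 1)) * L\<^sup>2 * (elliptic_K k)\<^sup>2)"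

definition wave_q :: "real \<Rightarrow> real" where
  "wave_q k = - 1 + k\<^sup>2 - sqrt (k ^ 4 - k\<^sup>2 + 1)"

definition wave_\<omega> :: "real \<Rightarrow> real \<Rightarrow> real" where
  "wave_\<omega> L k = 16 * (elliptic_K k)\<^sup>2 * sqrt (k ^ 4 - k\<^sup>2 + 1) / L\<^sup>2"

definition cnoidal_wave :: "real \<Rightarrow> real \<Rightarrow> real \<Rightarrow> real \<Rightarrow> real \<Rightarrow> real \<Rightarrow> real" where
  "cnoidal_wave \<kappa> \<gamma> B L k = cnoidal_profile \<kappa> \<gamma> B L (wave_a L k) (wave_q k) k"

definition modulus_of :: "real \<Rightarrow> real \<Rightarrow> real" where
  "modulus_of L \<omega> = (THE k. k \<in> {0<..<1} \<and> wave_\<omega> L k = \<omega>)"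

end

theory Submission
  imports Defs
begin

text \<open>
Set \<open>c = \<kappa> + \<gamma> B\<^sup>3 > 0\<close>, \<open>m = k\<^sup>2\<close>, \<open>r = \<surd>(m\<^sup>2 - m + 1)\<close>, \<open>q = -1 + m - r\<close> and \<open>b = 4 K(k) / L\<close>.

Let \<open>\<theta>(x)\<close> be the Jacobi amplitude at \<open>b x\<close>, so that \<open>\<theta>' = b \<surd>(1 - m sin\<^sup>2 \<theta>)\<close>. Differentiating
\<open>f(\<theta>) = cos \<theta> / \<surd>(1 - q sin\<^sup>2 \<theta>)\<close> twice along \<open>\<theta>(x)\<close> turns the wave equation into a polynomial identity
in \<open>sin\<^sup>2 \<theta>\<close>, which holds because \<open>q\<close> is a root of \<open>q\<^sup>2 + 2 (1 - m) q - m = 0\<close>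
(\<open>profile_equation\<close>). Periodicity holds because the amplitude grows by \<open>2 \<pi>\<close> when its argument grows
by \<open>4 K\<close>.

The ranges of \<open>a\<close> and \<open>\<omega>\<close>, and the bijectivity of \<open>k \<mapsto> \<omega>\<close>, come from the fact that
\<open>(2 - m + 2 r) K\<^sup>2\<close> and \<open>r K\<^sup>2\<close> increase with \<open>m\<close> from their values at \<open>m = 0\<close>. Both monotonicity
claims reduce to elementary inequalities once \<open>dK/dm \<ge> K/4\<close> is known (\<open>ell_K_deriv_ge\<close>), and
\<open>K \<rightarrow> \<infinity>\<close> as \<open>m \<rightarrow> 1\<close> gives surjectivity.

All smoothness claims rest on one computation: the integrals
\<open>\<integral>\<^sub>0\<^sup>\<theta> sin\<^sup>2\<^sup>n t (1 - m sin\<^sup>2 t) powr (-1/2-n) dt\<close> form a family that is closed under \<open>d/dm\<close>, hence each of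
them is smooth in \<open>(m, \<theta>)\<close>. The map \<open>(\<omega>, x) \<mapsto> (k, \<theta>)\<close> inverts an explicit smooth map of the plane with
positive Jacobian, so it is smooth (\<open>C_infinity_on_planar_inverse\<close>), and the wave is an explicit
smooth function of \<open>(k, \<theta>)\<close>. Thus \<open>(\<omega>, x) \<mapsto> \<phi>\<^sub>\<omega>(x)\<close> is jointly smooth and \<open>L\<close>-periodic in \<open>x\<close>.

Joint smoothness gives a smooth curve in every \<open>H\<^sup>s\<close>. Applying
\<open>1 - (L / 2\<pi>)\<^sup>2 d\<^sup>2/dx\<^sup>2\<close>, which multiplies the \<open>n\<close>-th Fourier coefficient by \<open>1 + n\<^sup>2\<close>, shows that the
coefficients of every \<open>\<omega>\<close>-derivative decay faster than any power of \<open>n\<close>, locally uniformly in \<open>\<omega>\<close>. A Taylor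
estimate for each coefficient, as a function of \<open>\<omega>\<close>, then bounds the Sobolev norm of the error of
the difference quotient by a multiple of the increment
(\<open>smooth_periodic_family_has_Hs_derivative\<close>).
\<close>

section \<open>Calculus of smooth maps\<close>

lemma C_diff_on_cong:
  assumes "open S" and "\<And>x. x \<in> S \<Longrightarrow> f x = g x"
  shows "C_diff_on n f S \<longleftrightarrow> C_diff_on n g S"
  using assms(2)
proof (induction n arbitrary: f g)
  case 0
  then show ?case by (simp cong: continuous_on_cong)
next
  case (Suc n)
  have d: "(f has_derivative D) (at x) \<longleftrightarrow> (g has_derivative D) (at x)" if "x \<in> S" for x D
    using has_derivative_transform_within_open[OF _ assms(1) that] Suc.prems by metis
  have "f differentiable (at x) \<longleftrightarrow> g differentiable (at x)" if "x \<in> S" for x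
    using d[OF that] by (simp add: differentiable_def)
  moreover have "frechet_derivative f (at x) = frechet_derivative g (at x)" if "x \<in> S" for x
    using d[OF that] by (simp add: frechet_derivative_def)
  ultimately show ?case
    using Suc.IH[of "\<lambda>x. frechet_derivative f (at x) v" "\<lambda>x. frechet_derivative g (at x) v" for v]
    by (simp cong: ball_cong)
qed

lemma C_diff_on_SucI:
  assumes "open S" and "\<And>x. x \<in> S \<Longrightarrow> (f has_derivative f' x) (at x)"
    and "\<And>v. C_diff_on n (\<lambda>x. f' x v) S"
  shows "C_diff_on (Suc n) f S"
proof -
  have "frechet_derivative f (at x) = f' x" if "x \<in> S" for x
    using frechet_derivative_at[OF assms(2)[OF that]] by simp
  then have "C_diff_on n (\<lambda>x. frechet_derivative f (at x) v) S" for v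
    using C_diff_on_cong[OF assms(1), of "\<lambda>x. frechet_derivative f (at x) v" "\<lambda>x. f' x v"]
      assms(3) by simp
  then show ?thesis
    using assms(2) by (auto simp: differentiable_def)
qed

lemma C_diff_on_Suc_has_derivative:
  assumes "C_diff_on (Suc n) f S" "x \<in> S"
  shows "(f has_derivative frechet_derivative f (at x)) (at x)"
  using assms by (simp add: frechet_derivative_works)

lemma C_diff_on_SucD: "C_diff_on (Suc n) f S \<Longrightarrow> C_diff_on n f S"
proof (induction n arbitrary: f)
  case 0
  then show ?case
    by (auto intro!: continuous_at_imp_continuous_on differentiable_imp_continuous_within)
next
  case (Suc n)
  then show ?case by simp
qed

lemma C_diff_on_const:
  assumes "open S"
  shows "C_diff_on n (\<lambda>x. c) S"
proof (induction n arbitrary: c)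
  case (Suc n)
  show ?case
    by (rule C_diff_on_SucI[OF assms, where f' = "\<lambda>x v. 0"]) (auto intro: Suc)
qed simp

lemma C_diff_on_bounded_linear:
  assumes h: "bounded_linear h" and "open S" and "C_diff_on n f S"
  shows "C_diff_on n (\<lambda>x. h (f x)) S"
  using assms(3)
proof (induction n arbitrary: f)
  case 0
  then show ?case by (simp add: bounded_linear.continuous_on[OF h])
next
  case (Suc n)
  show ?case
    by (rule C_diff_on_SucI[OF assms(2),
          where f' = "\<lambda>x v. h (frechet_derivative f (at x) v)"])
      (use Suc in \<open>auto intro!: bounded_linear.has_derivative[OF h]
          simp: frechet_derivative_works[symmetric]\<close>)
qed

lemma C_diff_on_ident:
  assumes "open S"
  shows "C_diff_on n (\<lambda>x. x) S"
proof (cases n)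
  case (Suc m)
  show ?thesis unfolding Suc
    by (rule C_diff_on_SucI[OF assms, where f' = "\<lambda>x v. v"])
      (auto intro: C_diff_on_const[OF assms])
qed simp

lemma C_diff_on_add:
  assumes "open S" and "C_diff_on n f S" and "C_diff_on n g S"
  shows "C_diff_on n (\<lambda>x. f x + g x) S"
  using assms(2,3)
proof (induction n arbitrary: f g)
  case 0
  then show ?case by (simp add: continuous_on_add)
next
  case (Suc n)
  show ?case
    by (rule C_diff_on_SucI[OF assms(1), where
          f' = "\<lambda>x v. frechet_derivative f (at x) v + frechet_derivative g (at x) v"])
      (use Suc in \<open>auto intro!: has_derivative_add simp: frechet_derivative_works[symmetric]\<close>)
qed

lemma C_diff_on_bounded_bilinear:
  assumes b: "bounded_bilinear b" and "open S" and "C_diff_on n f S" and "C_diff_on n g S"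
  shows "C_diff_on n (\<lambda>x. b (f x) (g x)) S"
  using assms(3,4)
proof (induction n arbitrary: f g)
  case 0
  then show ?case by (simp add: bounded_bilinear.continuous_on[OF b])
next
  case (Suc n)
  show ?case
  proof (rule C_diff_on_SucI[OF assms(2), where f' =
        "\<lambda>x v. b (f x) (frechet_derivative g (at x) v) + b (frechet_derivative f (at x) v) (g x)"])
    show "((\<lambda>x. b (f x) (g x)) has_derivative
        (\<lambda>v. b (f x) (frechet_derivative g (at x) v) + b (frechet_derivative f (at x) v) (g x)))
        (at x)" if "x \<in> S" for x
      by (rule bounded_bilinear.FDERIV[OF b]; rule C_diff_on_Suc_has_derivative; fact)
    show "C_diff_on n (\<lambda>x. b (f x) (frechet_derivative g (at x) v)
        + b (frechet_derivative f (at x) v) (g x)) S" for v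
      by (intro C_diff_on_add[OF assms(2)] Suc.IH)
        (use Suc.prems C_diff_on_SucD[OF Suc.prems(1)] C_diff_on_SucD[OF Suc.prems(2)] in auto)
  qed
qed

lemma C_diff_on_sum:
  assumes "open S" and "\<And>i. i \<in> A \<Longrightarrow> C_diff_on n (f i) S"
  shows "C_diff_on n (\<lambda>x. \<Sum>i\<in>A. f i x) S"
  using assms(2)
  by (induction A rule: infinite_finite_induct)
    (auto intro: C_diff_on_const C_diff_on_add assms(1))

text \<open>
The induction is on the order. In an orthonormal basis the chain rule reads
\<open>(g \<circ> f)' v = \<Sum>b. (f' v \<bullet> b) g'(f x) b\<close>, so it involves only the directional derivatives of \<open>g\<close>
along finitely many fixed directions, to which the induction hypothesis applies. This is where the
finite dimension of the middle space enters.
\<close>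

lemma C_diff_on_compose:
  fixes f :: "'a::real_normed_vector \<Rightarrow> 'b::euclidean_space" and g :: "'b \<Rightarrow> 'c::real_normed_vector"
  assumes S: "open S" and T: "open T" and fST: "\<And>x. x \<in> S \<Longrightarrow> f x \<in> T"
    and "C_diff_on n f S" and "C_diff_on n g T"
  shows "C_diff_on n (\<lambda>x. g (f x)) S"
  using assms(4,5)
proof (induction n arbitrary: g)
  case 0
  then show ?case using fST
    by (auto intro!: continuous_on_compose2[of T g S f])
next
  case (Suc n)
  let ?f' = "\<lambda>x. frechet_derivative f (at x)" and ?g' = "\<lambda>y. frechet_derivative g (at y)"
  show ?case
  proof (rule C_diff_on_SucI[OF S, where f' = "\<lambda>x v. \<Sum>b\<in>Basis. (?f' x v \<bullet> b) *\<^sub>R ?g' (f x) b"])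
    fix x assume x: "x \<in> S"
    have df: "(f has_derivative ?f' x) (at x)"
      by (rule C_diff_on_Suc_has_derivative) (use x Suc in auto)
    have dg: "(g has_derivative ?g' (f x)) (at (f x))"
      by (rule C_diff_on_Suc_has_derivative) (use fST[OF x] Suc in auto)
    interpret g': bounded_linear "?g' (f x)" using dg by (rule has_derivative_bounded_linear)
    have "?g' (f x) (?f' x v) = (\<Sum>b\<in>Basis. (?f' x v \<bullet> b) *\<^sub>R ?g' (f x) b)" for v
    proof -
      have "?g' (f x) (?f' x v) = ?g' (f x) (\<Sum>b\<in>Basis. (?f' x v \<bullet> b) *\<^sub>R b)"
        by (simp add: euclidean_representation)
      then show ?thesis by (simp add: g'.sum g'.scale)
    qed
    then show "((\<lambda>x. g (f x)) has_derivative (\<lambda>v. \<Sum>b\<in>Basis. (?f' x v \<bullet> b) *\<^sub>R ?g' (f x) b)) (at x)"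
      using has_derivative_compose[OF df dg] by simp
  next
    fix v
    have f': "C_diff_on n (\<lambda>x. ?f' x v \<bullet> b) S" for b
      by (rule C_diff_on_bounded_linear[OF bounded_linear_inner_left S]) (use Suc.prems in simp)
    have g': "C_diff_on n (\<lambda>x. ?g' (f x) b) S" for b
      using Suc.prems(2) by (intro Suc.IH C_diff_on_SucD[OF Suc.prems(1)]) simp
    show "C_diff_on n (\<lambda>x. \<Sum>b\<in>Basis. (?f' x v \<bullet> b) *\<^sub>R ?g' (f x) b) S"
      by (rule C_diff_on_sum[OF S], rule C_diff_on_bounded_bilinear[OF bounded_bilinear_scaleR S f' g'])
  qed
qed

lemma C_diff_on_Pair:
  assumes "open S" and "C_diff_on n f S" and "C_diff_on n g S"
  shows "C_diff_on n (\<lambda>x. (f x, g x)) S"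
proof -
  have l: "bounded_linear (\<lambda>a. (a, 0))" "bounded_linear (\<lambda>a. (0, a))"
    by (auto intro!: bounded_linear_Pair bounded_linear_ident bounded_linear_zero)
  have "C_diff_on n (\<lambda>x. (f x, 0) + (0, g x)) S"
    by (rule C_diff_on_add[OF assms(1) C_diff_on_bounded_linear[OF l(1) assms(1,2)]
          C_diff_on_bounded_linear[OF l(2) assms(1,3)]])
  then show ?thesis by simp
qed

lemma C_diff_on_Suc_real:
  fixes f :: "real \<Rightarrow> real"
  assumes "open S" and "\<And>x. x \<in> S \<Longrightarrow> (f has_real_derivative f' x) (at x)"
    and "C_diff_on n f' S"
  shows "C_diff_on (Suc n) f S"
proof (rule C_diff_on_SucI[OF assms(1)])
  show "(f has_derivative (\<lambda>v. f' x * v)) (at x)" if "x \<in> S" for x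
    using assms(2)[OF that] by (simp add: has_field_derivative_def)
  show "C_diff_on n (\<lambda>x. f' x * v) S" for v
    by (rule C_diff_on_bounded_linear[OF bounded_linear_mult_left assms(1,3)])
qed

lemma C_infinity_on_imp_differentiable:
  "C_infinity_on f S \<Longrightarrow> x \<in> S \<Longrightarrow> (f has_derivative frechet_derivative f (at x)) (at x)"
  unfolding C_infinity_on_def by (rule C_diff_on_Suc_has_derivative[where n = 0]) auto

lemma C_infinity_on_imp_continuous_on: "C_infinity_on f S \<Longrightarrow> continuous_on S f"
  unfolding C_infinity_on_def using C_diff_on.simps(1)[of f S] by blast

lemma C_infinity_on_frechet_derivative:
  "C_infinity_on f S \<Longrightarrow> C_infinity_on (\<lambda>x. frechet_derivative f (at x) v) S"
  unfolding C_infinity_on_def using C_diff_on.simps(2)[of _ f S] by blast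

lemma C_infinity_on_cong:
  "open S \<Longrightarrow> (\<And>x. x \<in> S \<Longrightarrow> f x = g x) \<Longrightarrow> C_infinity_on f S \<longleftrightarrow> C_infinity_on g S"
  unfolding C_infinity_on_def using C_diff_on_cong by blast

context
  fixes S :: "'a::real_normed_vector set"
  assumes S: "open S"
begin

lemma C_infinity_on_const: "C_infinity_on (\<lambda>x. c) S"
  by (simp add: C_infinity_on_def C_diff_on_const S)

lemma C_infinity_on_ident: "C_infinity_on (\<lambda>x. x) S"
  by (simp add: C_infinity_on_def C_diff_on_ident S)

lemma C_infinity_on_bounded_linear:
  "bounded_linear h \<Longrightarrow> C_infinity_on f S \<Longrightarrow> C_infinity_on (\<lambda>x. h (f x)) S"
  unfolding C_infinity_on_def using C_diff_on_bounded_linear[OF _ S] by blast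

lemma C_infinity_on_fst: "C_infinity_on f S \<Longrightarrow> C_infinity_on (\<lambda>x. fst (f x)) S"
  by (rule C_infinity_on_bounded_linear[OF bounded_linear_fst])

lemma C_infinity_on_snd: "C_infinity_on f S \<Longrightarrow> C_infinity_on (\<lambda>x. snd (f x)) S"
  by (rule C_infinity_on_bounded_linear[OF bounded_linear_snd])

lemma C_infinity_on_minus: "C_infinity_on f S \<Longrightarrow> C_infinity_on (\<lambda>x. - f x) S"
  by (rule C_infinity_on_bounded_linear[OF bounded_linear_minus[OF bounded_linear_ident]])

lemma C_infinity_on_add:
  "C_infinity_on f S \<Longrightarrow> C_infinity_on g S \<Longrightarrow> C_infinity_on (\<lambda>x. f x + g x) S"
  unfolding C_infinity_on_def using C_diff_on_add[OF S] by blast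

lemma C_infinity_on_diff:
  "C_infinity_on f S \<Longrightarrow> C_infinity_on g S \<Longrightarrow> C_infinity_on (\<lambda>x. f x - g x) S"
  using C_infinity_on_add[OF _ C_infinity_on_minus, of f g] by simp

lemma C_infinity_on_mult:
  fixes f g :: "'a \<Rightarrow> real"
  shows "C_infinity_on f S \<Longrightarrow> C_infinity_on g S \<Longrightarrow> C_infinity_on (\<lambda>x. f x * g x) S"
  unfolding C_infinity_on_def using C_diff_on_bounded_bilinear[OF bounded_bilinear_mult S] by blast

lemma C_infinity_on_power:
  fixes f :: "'a \<Rightarrow> real"
  shows "C_infinity_on f S \<Longrightarrow> C_infinity_on (\<lambda>x. f x ^ n) S"
  by (induction n) (auto intro: C_infinity_on_const C_infinity_on_mult)

lemma C_infinity_on_Pair: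
  "C_infinity_on f S \<Longrightarrow> C_infinity_on g S \<Longrightarrow> C_infinity_on (\<lambda>x. (f x, g x)) S"
  unfolding C_infinity_on_def using C_diff_on_Pair[OF S] by blast

lemma C_infinity_on_compose:
  fixes f :: "'a \<Rightarrow> 'b::euclidean_space"
  assumes "C_infinity_on g T" and "open T" and "C_infinity_on f S" and "\<And>x. x \<in> S \<Longrightarrow> f x \<in> T"
  shows "C_infinity_on (\<lambda>x. g (f x)) S"
proof -
  have "C_diff_on n (\<lambda>x. g (f x)) S" for n
    by (rule C_diff_on_compose[OF S assms(2,4)])
      (use assms(1,3) in \<open>auto simp: C_infinity_on_def\<close>)
  then show ?thesis by (simp add: C_infinity_on_def)
qed

end

lemma C_infinity_on_powr_const: "C_infinity_on (\<lambda>x::real. x powr a) {0<..}"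
proof -
  have "C_diff_on n (\<lambda>x::real. x powr a) {0<..}" for n
  proof (induction n arbitrary: a)
    case 0
    then show ?case by (auto intro!: continuous_intros)
  next
    case (Suc n)
    show ?case
    proof (rule C_diff_on_Suc_real)
      show "((\<lambda>x. x powr a) has_real_derivative a * x powr (a - 1)) (at x)" if "x \<in> {0<..}" for x
        using that by (auto intro!: derivative_eq_intros)
      show "C_diff_on n (\<lambda>x. a * x powr (a - 1)) {0<..}"
        by (rule C_diff_on_bounded_linear[OF bounded_linear_mult_right]) (auto intro: Suc)
    qed simp
  qed
  then show ?thesis by (simp add: C_infinity_on_def)
qed

lemma C_infinity_on_sin_cos_real:
  "C_infinity_on (sin :: real \<Rightarrow> real) UNIV" "C_infinity_on (cos :: real \<Rightarrow> real) UNIV"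
proof -
  have "C_diff_on n (sin :: real \<Rightarrow> real) UNIV \<and> C_diff_on n (cos :: real \<Rightarrow> real) UNIV" for n
  proof (induction n)
    case 0
    then show ?case by (auto intro!: continuous_intros)
  next
    case (Suc n)
    have "C_diff_on n (\<lambda>x::real. - sin x) UNIV"
      by (rule C_diff_on_bounded_linear[OF bounded_linear_minus[OF bounded_linear_ident]])
        (use Suc in auto)
    then show ?case
      using Suc by (auto intro!: C_diff_on_Suc_real derivative_eq_intros simp del: C_diff_on.simps)
  qed
  then show "C_infinity_on (sin :: real \<Rightarrow> real) UNIV" "C_infinity_on (cos :: real \<Rightarrow> real) UNIV"
    by (simp_all add: C_infinity_on_def)
qed

context
  fixes S :: "'a::real_normed_vector set" and f :: "'a \<Rightarrow> real"
  assumes S: "open S" and f: "C_infinity_on f S"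
begin

lemma C_infinity_on_sin: "C_infinity_on (\<lambda>x. sin (f x)) S"
  and C_infinity_on_cos: "C_infinity_on (\<lambda>x. cos (f x)) S"
  by (rule C_infinity_on_compose[OF S C_infinity_on_sin_cos_real(1) open_UNIV f]
      C_infinity_on_compose[OF S C_infinity_on_sin_cos_real(2) open_UNIV f]; simp)+

lemma C_infinity_on_powr: "(\<And>x. x \<in> S \<Longrightarrow> f x > 0) \<Longrightarrow> C_infinity_on (\<lambda>x. f x powr a) S"
  by (rule C_infinity_on_compose[OF S C_infinity_on_powr_const _ f]) auto

lemma C_infinity_on_inverse:
  assumes pos: "\<And>x. x \<in> S \<Longrightarrow> f x > 0"
  shows "C_infinity_on (\<lambda>x. inverse (f x)) S"
proof (rule C_infinity_on_cong[OF S, THEN iffD1])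
  show "C_infinity_on (\<lambda>x. f x powr -1) S" using pos by (rule C_infinity_on_powr)
next
  show "f x powr -1 = inverse (f x)" if "x \<in> S" for x
    using pos[OF that] by (simp add: powr_minus)
qed

lemma C_infinity_on_root:
  assumes pos: "\<And>x. x \<in> S \<Longrightarrow> f x > 0" and "n > 0"
  shows "C_infinity_on (\<lambda>x. root n (f x)) S"
proof (rule C_infinity_on_cong[OF S, THEN iffD1])
  show "C_infinity_on (\<lambda>x. f x powr (1 / n)) S" using pos by (rule C_infinity_on_powr)
next
  show "f x powr (1 / n) = root n (f x)" if "x \<in> S" for x
    using pos[OF that] \<open>n > 0\<close> by (simp add: root_powr_inverse)
qed

lemma C_infinity_on_sqrt:
  "(\<And>x. x \<in> S \<Longrightarrow> f x > 0) \<Longrightarrow> C_infinity_on (\<lambda>x. sqrt (f x)) S"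
  unfolding sqrt_def by (rule C_infinity_on_root) auto

end

lemma C_infinity_on_divide:
  fixes f g :: "'a::real_normed_vector \<Rightarrow> real"
  assumes "open S" "C_infinity_on f S" "C_infinity_on g S" "\<And>x. x \<in> S \<Longrightarrow> g x > 0"
  shows "C_infinity_on (\<lambda>x. f x / g x) S"
  unfolding divide_inverse
  using assms by (intro C_infinity_on_mult C_infinity_on_inverse)

lemmas C_infinity_on_intros =
  C_infinity_on_const C_infinity_on_ident C_infinity_on_fst C_infinity_on_snd
  C_infinity_on_minus C_infinity_on_add C_infinity_on_diff C_infinity_on_mult
  C_infinity_on_power C_infinity_on_Pair C_infinity_on_sin C_infinity_on_cos
  C_infinity_on_powr C_infinity_on_root C_infinity_on_sqrt C_infinity_on_divide

text \<open>
If the derivative of \<open>g\<close> is a smooth function of the value of \<open>g\<close>, then \<open>g\<close> being of class \<open>C\<^sup>n\<close> makes its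
derivative of class \<open>C\<^sup>n\<close> by the chain rule, and so \<open>g\<close> is of class \<open>C\<^sup>n\<^sup>+\<^sup>1\<close>. Inverse functions have
derivatives of this form.
\<close>

lemma C_infinity_on_bootstrap:
  fixes g :: "'a::real_normed_vector \<Rightarrow> 'b::euclidean_space"
  assumes T: "open T" and S: "open S" and gTS: "\<And>y. y \<in> T \<Longrightarrow> g y \<in> S"
    and dg: "\<And>y. y \<in> T \<Longrightarrow> (g has_derivative G (g y)) (at y)"
    and G: "\<And>v. C_infinity_on (\<lambda>x. G x v) S"
  shows "C_infinity_on g T"
proof -
  have "C_diff_on n g T" for n
  proof (induction n)
    case 0
    then show ?case
      using dg by (auto intro!: continuous_at_imp_continuous_on has_derivative_continuous)
  next
    case (Suc n)
    show ?case
    proof (rule C_diff_on_SucI[OF T dg])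
      show "C_diff_on n (\<lambda>y. G (g y) v) T" for v
        using C_diff_on_compose[OF T S gTS Suc, of "\<lambda>x. G x v"] G
        by (simp add: C_infinity_on_def)
    qed
  qed
  then show ?thesis by (simp add: C_infinity_on_def)
qed

section \<open>Partial derivatives and inverses in the plane\<close>

abbreviation D1 :: "(real \<times> real \<Rightarrow> real) \<Rightarrow> real \<times> real \<Rightarrow> real" where
  "D1 f \<equiv> \<lambda>p. frechet_derivative f (at p) (1, 0)"

abbreviation D2 :: "(real \<times> real \<Rightarrow> real) \<Rightarrow> real \<times> real \<Rightarrow> real" where
  "D2 f \<equiv> \<lambda>p. frechet_derivative f (at p) (0, 1)"

lemma has_real_derivative_D1:
  assumes "C_infinity_on f S" "(t, x) \<in> S"
  shows "((\<lambda>t. f (t, x)) has_real_derivative D1 f (t, x)) (at t)"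
proof -
  have df: "(f has_derivative frechet_derivative f (at (t, x))) (at (t, x))"
    using assms by (rule C_infinity_on_imp_differentiable)
  have "((\<lambda>t. (t, x)) has_derivative (\<lambda>h. (h, 0))) (at t)"
    by (auto intro!: derivative_eq_intros)
  from has_derivative_compose[OF this df]
  have "((\<lambda>t. f (t, x)) has_derivative (\<lambda>h. frechet_derivative f (at (t, x)) (h *\<^sub>R (1, 0)))) (at t)"
    by simp
  then show ?thesis
    unfolding linear_cmul[OF has_derivative_linear[OF df]]
    by (simp add: has_field_derivative_def mult.commute[of _ "D1 f (t, x)"])
qed

lemma has_real_derivative_D2:
  assumes "C_infinity_on f S" "(t, x) \<in> S"
  shows "((\<lambda>x. f (t, x)) has_real_derivative D2 f (t, x)) (at x)"
proof -
  have df: "(f has_derivative frechet_derivative f (at (t, x))) (at (t, x))"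
    using assms by (rule C_infinity_on_imp_differentiable)
  have "((\<lambda>x. (t, x)) has_derivative (\<lambda>h. (0, h))) (at x)"
    by (auto intro!: derivative_eq_intros)
  from has_derivative_compose[OF this df]
  have "((\<lambda>x. f (t, x)) has_derivative (\<lambda>h. frechet_derivative f (at (t, x)) (h *\<^sub>R (0, 1)))) (at x)"
    by simp
  then show ?thesis
    unfolding linear_cmul[OF has_derivative_linear[OF df]]
    by (simp add: has_field_derivative_def mult.commute[of _ "D2 f (t, x)"])
qed

lemma frechet_derivative_eq_partials:
  assumes "C_infinity_on f S" "p \<in> S"
  shows "frechet_derivative f (at p) v = D1 f p * fst v + D2 f p * snd v"
proof -
  interpret linear "frechet_derivative f (at p)"
    by (rule has_derivative_linear[OF C_infinity_on_imp_differentiable[OF assms]])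
  have "frechet_derivative f (at p) v
      = frechet_derivative f (at p) (fst v *\<^sub>R (1, 0) + snd v *\<^sub>R (0, 1))"
    by simp
  also have "\<dots> = fst v *\<^sub>R D1 f p + snd v *\<^sub>R D2 f p"
    by (simp only: add scale)
  finally show ?thesis by simp
qed

text \<open>
The inverse function theorem makes \<open>h\<close> differentiable, with derivative the inverse of the Jacobian matrix
taken at \<open>h y\<close>. By Cramer's rule its entries are smooth functions of the point \<open>h y\<close>, so
the bootstrap applies.
\<close>

lemma C_infinity_on_planar_inverse:
  fixes h :: "real \<times> real \<Rightarrow> real \<times> real" and f g :: "real \<times> real \<Rightarrow> real"
  assumes S: "open S" and T: "open T"
    and f: "C_infinity_on f S" and g: "C_infinity_on g S"
    and jac: "\<And>p. p \<in> S \<Longrightarrow> D1 f p * D2 g p - D2 f p * D1 g p > 0"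
    and hT: "\<And>y. y \<in> T \<Longrightarrow> h y \<in> S"
    and left: "\<And>p. p \<in> S \<Longrightarrow> h (f p, g p) = p"
    and right: "\<And>y. y \<in> T \<Longrightarrow> (f (h y), g (h y)) = y"
  shows "C_infinity_on h T"
proof -
  define a b c d where "a = D1 f" and "b = D2 f" and "c = D1 g" and "d = D2 g"
  define J where "J p = a p * d p - b p * c p" for p
  define G where "G p v = ((d p * fst v - b p * snd v) / J p, (a p * snd v - c p * fst v) / J p)" for p v
  have J: "J p > 0" if "p \<in> S" for p
    using jac[OF that] by (simp add: J_def a_def b_def c_def d_def)
  have smooth: "C_infinity_on a S" "C_infinity_on b S" "C_infinity_on c S" "C_infinity_on d S"
    unfolding a_def b_def c_def d_def by (rule C_infinity_on_frechet_derivative, rule f g)+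
  have smooth_G: "C_infinity_on (\<lambda>p. G p v) S" for v
  proof -
    note cm = C_infinity_on_mult[OF S]
    note cd = C_infinity_on_diff[OF S]
    note k = C_infinity_on_const[OF S]
    have sJ: "C_infinity_on J S"
      unfolding J_def[abs_def] by (rule cd[OF cm[OF smooth(1,4)] cm[OF smooth(2,3)]])
    show ?thesis
      unfolding G_def
      by (rule C_infinity_on_Pair[OF S
            C_infinity_on_divide[OF S cd[OF cm[OF smooth(4) k] cm[OF smooth(2) k]] sJ J]
            C_infinity_on_divide[OF S cd[OF cm[OF smooth(1) k] cm[OF smooth(3) k]] sJ J]])
  qed
  have dh: "(h has_derivative G (h y)) (at y)" if y: "y \<in> T" for y
  proof -
    define p where "p = h y"
    have p: "p \<in> S" unfolding p_def by (rule hT[OF y])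
    define F' where "F' v = (a p * fst v + b p * snd v, c p * fst v + d p * snd v)" for v
    have "(h has_derivative G p) (at ((\<lambda>p. (f p, g p)) p))"
    proof (rule has_derivative_inverse_strong[OF S p, where g = h and f' = F' and g' = "G p"])
      show "continuous_on S (\<lambda>p. (f p, g p))"
        by (rule continuous_on_Pair[OF C_infinity_on_imp_continuous_on[OF f]
              C_infinity_on_imp_continuous_on[OF g]])
      have "((\<lambda>p. (f p, g p)) has_derivative
          (\<lambda>v. (frechet_derivative f (at p) v, frechet_derivative g (at p) v))) (at p)"
        by (rule has_derivative_Pair[OF C_infinity_on_imp_differentiable[OF f p]
              C_infinity_on_imp_differentiable[OF g p]])
      moreover have "frechet_derivative f (at p) v = a p * fst v + b p * snd v"
        "frechet_derivative g (at p) v = c p * fst v + d p * snd v" for v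
        unfolding a_def b_def c_def d_def
        by (rule frechet_derivative_eq_partials[OF f p] frechet_derivative_eq_partials[OF g p])+
      ultimately show "((\<lambda>p. (f p, g p)) has_derivative F') (at p)"
        unfolding F'_def[abs_def] by (simp only:)
      show "F' \<circ> G p = id"
      proof
        fix v :: "real \<times> real"
        have "a p * (d p * fst v - b p * snd v) + b p * (a p * snd v - c p * fst v) = J p * fst v"
          "c p * (d p * fst v - b p * snd v) + d p * (a p * snd v - c p * fst v) = J p * snd v"
          by (simp_all add: J_def algebra_simps)
        then show "(F' \<circ> G p) v = id v"
          using J[OF p] by (simp add: F'_def G_def add_divide_distrib[symmetric])
      qed
    qed (rule left)
    then show ?thesis
      using right[OF y] by (simp add: p_def)
  qed
  show ?thesis
    by (rule C_infinity_on_bootstrap[where G = G, OF T S hT dh smooth_G])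
qed

section \<open>Fourier coefficients\<close>

lemma continuous_on_fourier_integrand:
  "continuous_on S f \<Longrightarrow> continuous_on S (\<lambda>x. of_real (f x) * cis (- 2 * pi * of_int n * x / L))"
  unfolding cis_conv_exp divide_inverse by (intro continuous_intros)

lemma fourier_coeff_eq_integral:
  assumes "continuous_on {0..L} f"
  shows "fourier_coeff L f n =
    (1 / of_real L) * integral {0..L} (\<lambda>x. of_real (f x) * cis (- 2 * pi * of_int n * x / L))"
  unfolding fourier_coeff_def
  using set_lebesgue_integral_eq_integral(2)[OF absolutely_integrable_continuous_real,
      OF continuous_on_fourier_integrand[OF assms]]
  by simp

lemma fourier_coeff_linear:
  assumes "continuous_on {0..L} f" "continuous_on {0..L} g"
  shows "fourier_coeff L (\<lambda>x. c * f x + d * g x) n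
    = of_real c * fourier_coeff L f n + of_real d * fourier_coeff L g n"
proof -
  let ?e = "\<lambda>x. cis (- 2 * pi * of_int n * x / L)"
  have i: "(\<lambda>x. of_real (f x) * ?e x) integrable_on {0..L}" "(\<lambda>x. of_real (g x) * ?e x) integrable_on {0..L}"
    by (intro integrable_continuous_interval continuous_on_fourier_integrand assms)+
  have "integral {0..L} (\<lambda>x. of_real (c * f x + d * g x) * ?e x)
      = integral {0..L} (\<lambda>x. of_real c * (of_real (f x) * ?e x) + of_real d * (of_real (g x) * ?e x))"
    by (simp add: algebra_simps)
  also have "\<dots> = of_real c * integral {0..L} (\<lambda>x. of_real (f x) * ?e x)
      + of_real d * integral {0..L} (\<lambda>x. of_real (g x) * ?e x)"
    using i by (simp add: integral_add integrable_on_mult_right)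
  finally show ?thesis
    unfolding fourier_coeff_eq_integral[OF assms(1)] fourier_coeff_eq_integral[OF assms(2)]
      fourier_coeff_eq_integral[OF continuous_on_add[OF continuous_on_mult_left[OF assms(1)]
          continuous_on_mult_left[OF assms(2)]], of c d]
    by (simp only: distrib_left mult.left_commute)
qed

lemma norm_fourier_coeff_le:
  assumes "L > 0" "continuous_on {0..L} f" "\<And>x. x \<in> {0..L} \<Longrightarrow> \<bar>f x\<bar> \<le> M"
  shows "norm (fourier_coeff L f n) \<le> M"
proof -
  let ?e = "\<lambda>x. cis (- 2 * pi * of_int n * x / L)"
  have "norm (integral {0..L} (\<lambda>x. of_real (f x) * ?e x)) \<le> M * (L - 0)"
    by (rule integral_bound[OF _ continuous_on_fourier_integrand[OF assms(2)]])
      (use assms in \<open>auto simp: norm_mult\<close>)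
  then show ?thesis
    using assms(1) by (simp add: fourier_coeff_eq_integral[OF assms(2)] norm_mult norm_divide field_simps)
qed

text \<open>
Integration by parts over a period: the boundary terms of \<open>f e\<^sub>n\<close> cancel, where \<open>e\<^sub>n\<close> is the \<open>n\<close>-th
exponential.
\<close>

lemma fourier_coeff_deriv:
  assumes "L > 0" "periodic L f"
    and d: "\<And>x. (f has_real_derivative f' x) (at x)" and c: "continuous_on UNIV f'"
  shows "fourier_coeff L f' n = \<i> * of_real (2 * pi * of_int n / L) * fourier_coeff L f n"
proof -
  let ?e = "\<lambda>x. cis (- 2 * pi * of_int n * x / L)"
  let ?w = "\<i> * of_real (2 * pi * of_int n / L)"
  have cf: "continuous_on UNIV f"
    using d by (auto intro!: continuous_at_imp_continuous_on DERIV_isCont)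
  have e: "(?e has_vector_derivative - ?w * ?e x) (at x within {0..L})" for x
  proof -
    have eq: "?e y = exp (- ?w * of_real y)" for y
      by (simp add: cis_conv_exp mult_ac)
    have "((\<lambda>z. exp (- ?w * z)) has_field_derivative exp (- ?w * of_real x) * - ?w) (at (of_real x))"
      by (rule DERIV_chain'[OF DERIV_cmult_Id DERIV_exp])
    then have "((\<lambda>x. exp (- ?w * of_real x)) has_vector_derivative exp (- ?w * of_real x) * - ?w)
        (at x within {0..L})"
      by (rule has_vector_derivative_real_field)
    then show ?thesis
      unfolding eq by (simp only: mult.commute)
  qed
  have "((\<lambda>x. of_real (f x) * ?e x) has_vector_derivative
      of_real (f' x) * ?e x - ?w * (of_real (f x) * ?e x)) (at x within {0..L})" for x
  proof -
    have "((\<lambda>x. complex_of_real (f x)) has_vector_derivative of_real (f' x)) (at x within {0..L})"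
      by (rule has_vector_derivative_of_real[OF has_field_derivative_at_within[OF d]])
    from has_vector_derivative_mult[OF this e[of x]]
    have "((\<lambda>x. of_real (f x) * ?e x) has_vector_derivative
       of_real (f x) * (- ?w * ?e x) + of_real (f' x) * ?e x) (at x within {0..L})" .
    moreover have "of_real (f x) * (- ?w * ?e x) + of_real (f' x) * ?e x
        = of_real (f' x) * ?e x - ?w * (of_real (f x) * ?e x)"
      by algebra
    ultimately show ?thesis by (simp only:)
  qed
  then have "((\<lambda>x. of_real (f' x) * ?e x - ?w * (of_real (f x) * ?e x)) has_integral
      of_real (f L) * ?e L - of_real (f 0) * ?e 0) {0..L}"
    using \<open>L > 0\<close> by (intro fundamental_theorem_of_calculus) auto
  moreover have "f L = f 0"
    using assms(2) unfolding periodic_def by (metis add_0)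
  moreover have "?e L = 1"
  proof -
    have "- 2 * pi * of_int n * L / L = 2 * pi * of_int (- n)" using \<open>L > 0\<close> by simp
    then show ?thesis using cis_multiple_2pi[of "of_int (- n)"] by simp
  qed
  ultimately have "((\<lambda>x. of_real (f' x) * ?e x - ?w * (of_real (f x) * ?e x)) has_integral 0) {0..L}"
    by simp
  then have "integral {0..L} (\<lambda>x. of_real (f' x) * ?e x - ?w * (of_real (f x) * ?e x)) = 0"
    by (rule integral_unique)
  moreover have i: "(\<lambda>x. of_real (f x) * ?e x) integrable_on {0..L}" "(\<lambda>x. of_real (f' x) * ?e x) integrable_on {0..L}"
    by (intro integrable_continuous_interval continuous_on_fourier_integrand
        continuous_on_subset[OF cf] continuous_on_subset[OF c] subset_UNIV)+
  ultimately have "integral {0..L} (\<lambda>x. of_real (f' x) * ?e x)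
      = ?w * integral {0..L} (\<lambda>x. of_real (f x) * ?e x)"
    unfolding integral_diff[OF i(2) integrable_on_mult_right[OF i(1)]] integral_mult_right
    by (simp only: right_minus_eq)
  then show ?thesis
    unfolding fourier_coeff_eq_integral[OF continuous_on_subset[OF c subset_UNIV]]
      fourier_coeff_eq_integral[OF continuous_on_subset[OF cf subset_UNIV]]
    by (simp only: mult.left_commute)
qed

section \<open>Decay of Fourier coefficients and Sobolev norms\<close>

lemma summable_on_int_inverse_square: "(\<lambda>n::int. 1 / (1 + (of_int n)\<^sup>2) :: real) summable_on UNIV"
proof -
  have "summable (\<lambda>n. 1 / (1 + (real n)\<^sup>2))"
  proof (rule summable_comparison_test')
    show "summable (\<lambda>n. inverse (real n ^ 2))"
      using inverse_power_summable[of 2, where 'a = real] by simp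
    show "norm (1 / (1 + (real n)\<^sup>2)) \<le> inverse (real n ^ 2)" if "n \<ge> 1" for n
      using that le_imp_inverse_le[of "(real n)\<^sup>2" "1 + (real n)\<^sup>2"] by (simp add: divide_inverse)
  qed
  then have "(\<lambda>n. 1 / (1 + (real n)\<^sup>2)) summable_on UNIV"
    by (intro norm_summable_imp_summable_on) simp
  then have nat: "(\<lambda>n. 1 / (1 + (real n)\<^sup>2)) summable_on A" for A
    by (rule summable_on_subset_banach) simp
  have "(\<lambda>n::int. 1 / (1 + (of_int n)\<^sup>2) :: real) summable_on (int ` UNIV \<union> (\<lambda>n. - int n) ` {1..})"
  proof (rule summable_on_Un_disjoint)
    show "(\<lambda>n::int. 1 / (1 + (of_int n)\<^sup>2) :: real) summable_on (int ` UNIV)"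
      by (subst summable_on_reindex) (auto simp: o_def nat inj_on_def)
    show "(\<lambda>n::int. 1 / (1 + (of_int n)\<^sup>2) :: real) summable_on ((\<lambda>n. - int n) ` {1..})"
      by (subst summable_on_reindex) (auto simp: o_def nat inj_on_def)
  qed auto
  moreover have "int ` UNIV \<union> (\<lambda>n. - int n) ` {1..} = UNIV"
  proof -
    have "x \<in> int ` UNIV \<union> (\<lambda>n. - int n) ` {1..}" for x
    proof (cases "x \<ge> 0")
      case True
      then show ?thesis by (metis UnI1 nat_0_le rangeI)
    next
      case False
      then have "x = - int (nat (- x))" "nat (- x) \<in> {1..}" by auto
      then show ?thesis by blast
    qed
    then show ?thesis by blast
  qed
  ultimately show ?thesis by simp
qed

text \<open>
The squared hypothesis controls at least one factor \<open>1 + n\<^sup>2\<close> more than the weight of \<open>H\<^sup>s\<close>. This leaves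
a summable majorant, so a bound on the weighted coefficients bounds the Sobolev norm.
\<close>

lemma Hs_weights_le:
  assumes decay: "\<And>n. (1 + (of_int n)\<^sup>2) ^ Suc s * norm (fourier_coeff L f n) \<le> C"
  shows "(1 + (of_int n)\<^sup>2) ^ s * (norm (fourier_coeff L f n))\<^sup>2 \<le> C\<^sup>2 * (1 / (1 + (of_int n)\<^sup>2))"
proof -
  let ?w = "1 + (of_int n)\<^sup>2 :: real" and ?c = "norm (fourier_coeff L f n)"
  have w: "?w \<ge> 1" by simp
  have "?w * (?w ^ s * ?c\<^sup>2) \<le> ?w ^ Suc s * (?w ^ Suc s * ?c\<^sup>2)"
  proof -
    have "?w * (?w ^ s * ?c\<^sup>2) * 1 \<le> ?w * (?w ^ s * ?c\<^sup>2) * ?w ^ Suc s"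
      using w by (intro mult_left_mono one_le_power) auto
    then show ?thesis by (simp add: mult_ac)
  qed
  also have "\<dots> = (?w ^ Suc s * ?c)\<^sup>2" by (simp add: power2_eq_square)
  also have "\<dots> \<le> C\<^sup>2" using decay[of n] w by (intro power_mono) auto
  finally have "(?w ^ s * ?c\<^sup>2) * ?w \<le> C\<^sup>2" by (simp only: mult.commute)
  moreover have "?w > 0" using w by linarith
  ultimately show ?thesis by (simp only: pos_le_divide_eq times_divide_eq_right mult_1_right)
qed

lemma Hs_summable_of_decay:
  assumes "\<And>n. (1 + (of_int n)\<^sup>2) ^ Suc s * norm (fourier_coeff L f n) \<le> C"
  shows "(\<lambda>n. (1 + (of_int n)\<^sup>2) ^ s * (norm (fourier_coeff L f n))\<^sup>2) summable_on UNIV"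
proof (rule summable_on_comparison_test)
  show "(\<lambda>n::int. C\<^sup>2 * (1 / (1 + (of_int n)\<^sup>2))) summable_on UNIV"
    by (rule summable_on_cmult_right[OF summable_on_int_inverse_square])
  show "(1 + (of_int n)\<^sup>2) ^ s * (norm (fourier_coeff L f n))\<^sup>2 \<le> C\<^sup>2 * (1 / (1 + (of_int n)\<^sup>2))" for n
    by (rule Hs_weights_le[OF assms])
qed simp

lemma Hs_norm_le_of_decay:
  assumes "L > 0" and decay: "\<And>n. (1 + (of_int n)\<^sup>2) ^ Suc s * norm (fourier_coeff L f n) \<le> C"
  shows "Hs_norm L s f \<le> C * sqrt (L * (\<Sum>\<^sub>\<infinity>n::int. 1 / (1 + (of_int n)\<^sup>2)))"
proof -
  have "C \<ge> 0" using decay[of 0] using order_trans[OF norm_ge_zero, of "fourier_coeff L f 0" C] by simp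
  have "(\<Sum>\<^sub>\<infinity>n. (1 + (of_int n)\<^sup>2) ^ s * (norm (fourier_coeff L f n))\<^sup>2)
      \<le> (\<Sum>\<^sub>\<infinity>n::int. C\<^sup>2 * (1 / (1 + (of_int n)\<^sup>2)))"
    by (rule infsum_mono[OF Hs_summable_of_decay[OF decay]
          summable_on_cmult_right[OF summable_on_int_inverse_square] Hs_weights_le[OF decay]])
  also have "\<dots> = C\<^sup>2 * (\<Sum>\<^sub>\<infinity>n::int. 1 / (1 + (of_int n)\<^sup>2))"
    by (rule infsum_cmult_right')
  finally have "Hs_norm L s f \<le> sqrt (C\<^sup>2 * (L * (\<Sum>\<^sub>\<infinity>n::int. 1 / (1 + (of_int n)\<^sup>2))))"
    unfolding Hs_norm_def using \<open>L > 0\<close> by (intro real_sqrt_le_mono) (simp add: mult_ac)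
  then show ?thesis using \<open>C \<ge> 0\<close> by (simp add: real_sqrt_mult)
qed

section \<open>Smooth periodic families as curves in Sobolev spaces\<close>

text \<open>
The first coordinate is the parameter of the curve, the second the space variable.
\<close>

definition smooth_periodic_family :: "real \<Rightarrow> real set \<Rightarrow> (real \<times> real \<Rightarrow> real) \<Rightarrow> bool" where
  "smooth_periodic_family L I f \<longleftrightarrow>
     C_infinity_on f (I \<times> UNIV) \<and> (\<forall>t\<in>I. periodic L (\<lambda>x. f (t, x)))"

lemma smooth_periodic_familyD:
  assumes "smooth_periodic_family L I f"
  shows "C_infinity_on f (I \<times> UNIV)" and "t \<in> I \<Longrightarrow> periodic L (\<lambda>x. f (t, x))"
  using assms by (auto simp: smooth_periodic_family_def)

lemma smooth_periodic_family_continuous: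
  assumes "smooth_periodic_family L I f" "t \<in> I"
  shows "continuous_on UNIV (\<lambda>x. f (t, x))"
  by (rule continuous_on_compose2[OF C_infinity_on_imp_continuous_on[OF smooth_periodic_familyD(1)[OF assms(1)]]])
    (use assms in \<open>auto intro!: continuous_intros\<close>)

text \<open>
Periodicity passes to derivatives because \<open>f\<close> agrees with its translate by \<open>(0, L)\<close> on the open set
\<open>I \<times> \<real>\<close>.
\<close>

lemma smooth_periodic_family_frechet_derivative:
  assumes I: "open I" and f: "smooth_periodic_family L I f"
  shows "smooth_periodic_family L I (\<lambda>p. frechet_derivative f (at p) v)"
  unfolding smooth_periodic_family_def
proof (intro conjI ballI)
  note C = smooth_periodic_familyD(1)[OF f]
  show "C_infinity_on (\<lambda>p. frechet_derivative f (at p) v) (I \<times> UNIV)"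
    by (rule C_infinity_on_frechet_derivative[OF C])
  fix t assume t: "t \<in> I"
  show "periodic L (\<lambda>x. frechet_derivative f (at (t, x)) v)"
    unfolding periodic_def
  proof
    fix x
    let ?sh = "\<lambda>p. p + (0, L)"
    have "(f has_derivative frechet_derivative f (at (t, x + L))) (at (t, x + L))"
      using C t by (intro C_infinity_on_imp_differentiable) auto
    then have "(f has_derivative frechet_derivative f (at (t, x + L))) (at (?sh (t, x)))"
      by simp
    moreover have "(?sh has_derivative (\<lambda>h. h)) (at (t, x))"
      by (auto intro!: derivative_eq_intros)
    ultimately have "((\<lambda>p. f (?sh p)) has_derivative frechet_derivative f (at (t, x + L))) (at (t, x))"
      using has_derivative_compose by fastforce
    then have "(f has_derivative frechet_derivative f (at (t, x + L))) (at (t, x))"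
    proof (rule has_derivative_transform_within_open)
      show "open (I \<times> (UNIV :: real set))" using I by (simp add: open_Times)
      show "(t, x) \<in> I \<times> UNIV" using t by simp
      show "f (?sh p) = f p" if "p \<in> I \<times> UNIV" for p
        using that smooth_periodic_familyD(2)[OF f] by (auto simp: periodic_def)
    qed
    then have "frechet_derivative f (at (t, x + L)) = frechet_derivative f (at (t, x))"
      by (rule frechet_derivative_at)
    then show "frechet_derivative f (at (t, x + L)) v = frechet_derivative f (at (t, x)) v"
      by simp
  qed
qed

text \<open>
The operator \<open>1 - (L / 2\<pi>)\<^sup>2 d\<^sup>2/dx\<^sup>2\<close>, scaled so that it acts on the \<open>n\<close>-th Fourier mode as
multiplication by \<open>1 + n\<^sup>2\<close>.
\<close>

definition bessel_op :: "real \<Rightarrow> (real \<times> real \<Rightarrow> real) \<Rightarrow> real \<times> real \<Rightarrow> real" where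
  "bessel_op L f = (\<lambda>p. f p - (L / (2 * pi))\<^sup>2 * D2 (D2 f) p)"

lemma smooth_periodic_family_bessel_op:
  assumes I: "open I" and f: "smooth_periodic_family L I f"
  shows "smooth_periodic_family L I (bessel_op L f)"
proof -
  have f2: "smooth_periodic_family L I (D2 (D2 f))"
    by (intro smooth_periodic_family_frechet_derivative I f)
  have "open (I \<times> (UNIV :: real set))" using I by (simp add: open_Times)
  then show ?thesis
    using smooth_periodic_familyD[OF f] smooth_periodic_familyD[OF f2]
    unfolding smooth_periodic_family_def bessel_op_def
    by (auto intro!: C_infinity_on_diff C_infinity_on_mult C_infinity_on_const simp: periodic_def)
qed

lemma fourier_coeff_bessel_op:
  assumes L: "L > 0" and I: "open I" and f: "smooth_periodic_family L I f" and t: "t \<in> I"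
  shows "fourier_coeff L (\<lambda>x. bessel_op L f (t, x)) n
    = of_real (1 + (of_int n)\<^sup>2) * fourier_coeff L (\<lambda>x. f (t, x)) n"
proof -
  have f1: "smooth_periodic_family L I (D2 f)"
    by (intro smooth_periodic_family_frechet_derivative I f)
  have f2: "smooth_periodic_family L I (D2 (D2 f))"
    by (intro smooth_periodic_family_frechet_derivative I f1)
  let ?w = "\<i> * of_real (2 * pi * of_int n / L)"
  have "fourier_coeff L (\<lambda>x. D2 (D2 f) (t, x)) n = ?w * fourier_coeff L (\<lambda>x. D2 f (t, x)) n"
    by (rule fourier_coeff_deriv[OF L smooth_periodic_familyD(2)[OF f1 t]
        has_real_derivative_D2[OF smooth_periodic_familyD(1)[OF f1]]
        smooth_periodic_family_continuous[OF f2 t]]) (use t in simp)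
  also have "fourier_coeff L (\<lambda>x. D2 f (t, x)) n = ?w * fourier_coeff L (\<lambda>x. f (t, x)) n"
    by (rule fourier_coeff_deriv[OF L smooth_periodic_familyD(2)[OF f t]
        has_real_derivative_D2[OF smooth_periodic_familyD(1)[OF f]]
        smooth_periodic_family_continuous[OF f1 t]]) (use t in simp)
  finally have c2: "fourier_coeff L (\<lambda>x. D2 (D2 f) (t, x)) n = ?w * (?w * fourier_coeff L (\<lambda>x. f (t, x)) n)" .
  have w: "of_real ((L / (2 * pi))\<^sup>2) * (?w * ?w) = - of_real ((of_int n)\<^sup>2)"
    using L by (simp add: power2_eq_square field_simps)
  have "fourier_coeff L (\<lambda>x. 1 * f (t, x) + (- ((L / (2 * pi))\<^sup>2)) * D2 (D2 f) (t, x)) n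
    = of_real 1 * fourier_coeff L (\<lambda>x. f (t, x)) n
      + of_real (- ((L / (2 * pi))\<^sup>2)) * fourier_coeff L (\<lambda>x. D2 (D2 f) (t, x)) n"
    by (rule fourier_coeff_linear)
      (rule continuous_on_subset[OF smooth_periodic_family_continuous[OF f t] subset_UNIV]
        continuous_on_subset[OF smooth_periodic_family_continuous[OF f2 t] subset_UNIV])+
  also have "\<dots> = fourier_coeff L (\<lambda>x. f (t, x)) n
      - (of_real ((L / (2 * pi))\<^sup>2) * (?w * ?w)) * fourier_coeff L (\<lambda>x. f (t, x)) n"
    unfolding c2 by (simp only: of_real_minus of_real_1 mult_1 mult_minus_left mult.assoc add_uminus_conv_diff)
  also have "\<dots> = of_real (1 + (of_int n)\<^sup>2) * fourier_coeff L (\<lambda>x. f (t, x)) n"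
    unfolding w by (simp add: algebra_simps)
  finally show ?thesis
    by (simp add: bessel_op_def)
qed

lemma fourier_coeff_bessel_op_iterate:
  assumes L: "L > 0" and I: "open I" and f: "smooth_periodic_family L I f"
  shows "smooth_periodic_family L I ((bessel_op L ^^ j) f)"
    and "t \<in> I \<Longrightarrow> fourier_coeff L (\<lambda>x. (bessel_op L ^^ j) f (t, x)) n
      = of_real (1 + (of_int n)\<^sup>2) ^ j * fourier_coeff L (\<lambda>x. f (t, x)) n"
proof (induction j)
  case 0
  { case 1 show ?case using f by simp next
    case 2 show ?case by simp }
next
  case (Suc j)
  { case 1 show ?case using Suc.IH(1) by (simp add: smooth_periodic_family_bessel_op[OF I]) next
    case 2 then show ?case using Suc.IH fourier_coeff_bessel_op[OF L I Suc.IH(1)] by simp }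
qed

text \<open>
By the previous lemma the left-hand side is a Fourier coefficient of the \<open>j\<close>-th Bessel iterate of \<open>f\<close>, which is
bounded on the compact set \<open>K \<times> [0, L]\<close>.
\<close>

lemma fourier_coeff_decay:
  assumes L: "L > 0" and I: "open I" and f: "smooth_periodic_family L I f"
    and K: "compact K" "K \<subseteq> I"
  shows "\<exists>M\<ge>0. \<forall>t\<in>K. \<forall>n. (1 + (of_int n)\<^sup>2) ^ j * norm (fourier_coeff L (\<lambda>x. f (t, x)) n) \<le> M"
proof -
  define g where "g = (bessel_op L ^^ j) f"
  have g: "smooth_periodic_family L I g"
    unfolding g_def by (rule fourier_coeff_bessel_op_iterate[OF L I f])
  have "compact (g ` (K \<times> {0..L}))"
    by (intro compact_continuous_image compact_Times K compact_Icc
        continuous_on_subset[OF C_infinity_on_imp_continuous_on[OF smooth_periodic_familyD(1)[OF g]]])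
      (use K in auto)
  then obtain M where M: "\<And>p. p \<in> K \<times> {0..L} \<Longrightarrow> \<bar>g p\<bar> \<le> M"
    using compact_imp_bounded bounded_iff[of "g ` (K \<times> {0..L})"] by auto
  have "(1 + (of_int n)\<^sup>2) ^ j * norm (fourier_coeff L (\<lambda>x. f (t, x)) n) \<le> max M 0" if t: "t \<in> K" for t n
  proof -
    have "norm (fourier_coeff L (\<lambda>x. g (t, x)) n) \<le> M"
      using t K M by (intro norm_fourier_coeff_le[OF L]
          continuous_on_subset[OF smooth_periodic_family_continuous[OF g]]) auto
    moreover have "norm (1 + (complex_of_int n)\<^sup>2) = 1 + (of_int n)\<^sup>2"
    proof -
      have "norm (complex_of_real (1 + (of_int n)\<^sup>2)) = 1 + (of_int n)\<^sup>2"
        unfolding norm_of_real by simp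
      then show ?thesis by simp
    qed
    ultimately show ?thesis
      using fourier_coeff_bessel_op_iterate(2)[OF L I f, of t j n] t K
      by (auto simp: g_def[symmetric] norm_mult norm_power)
  qed
  then show ?thesis by (intro exI[of _ "max M 0"]) auto
qed

text \<open>
Differentiation under the integral sign.
\<close>

lemma fourier_coeff_has_vector_derivative:
  assumes L: "L > 0" and I: "open I" and f: "smooth_periodic_family L I f" and t: "t \<in> I"
  shows "((\<lambda>t. fourier_coeff L (\<lambda>x. f (t, x)) n) has_vector_derivative
    fourier_coeff L (\<lambda>x. D1 f (t, x)) n) (at t)"
proof -
  let ?e = "\<lambda>x. cis (- 2 * pi * of_int n * x / L)"
  obtain \<epsilon> where \<epsilon>: "\<epsilon> > 0" "ball t \<epsilon> \<subseteq> I" using I t open_contains_ball by blast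
  have f1: "smooth_periodic_family L I (D1 f)"
    by (intro smooth_periodic_family_frechet_derivative I f)
  note cont = continuous_on_subset[OF smooth_periodic_family_continuous[OF f] subset_UNIV]
  note cont1 = continuous_on_subset[OF smooth_periodic_family_continuous[OF f1] subset_UNIV]
  have "((\<lambda>t. integral (cbox 0 L) (\<lambda>x. of_real (f (t, x)) * ?e x)) has_vector_derivative
      integral (cbox 0 L) (\<lambda>x. of_real (D1 f (t, x)) * ?e x)) (at t within ball t \<epsilon>)"
  proof (rule leibniz_rule_vector_derivative)
    fix s x assume s: "s \<in> ball t \<epsilon>"
    have "((\<lambda>t. f (t, x)) has_real_derivative D1 f (s, x)) (at s)"
      by (rule has_real_derivative_D1[OF smooth_periodic_familyD(1)[OF f]]) (use s \<epsilon> in auto)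
    then have "((\<lambda>t. complex_of_real (f (t, x))) has_vector_derivative of_real (D1 f (s, x)))
       (at s within ball t \<epsilon>)"
      by (rule has_vector_derivative_of_real[OF has_field_derivative_at_within])
    then show "((\<lambda>t. of_real (f (t, x)) * ?e x) has_vector_derivative of_real (D1 f (s, x)) * ?e x)
       (at s within ball t \<epsilon>)"
      by (rule bounded_linear.has_vector_derivative[OF bounded_linear_mult_left])
  next
    show "(\<lambda>x. of_real (f (s, x)) * ?e x) integrable_on cbox 0 L" if "s \<in> ball t \<epsilon>" for s
      unfolding cbox_interval
      by (intro integrable_continuous_interval continuous_on_fourier_integrand cont) (use that \<epsilon> in auto)
  next
    have c1: "continuous_on (ball t \<epsilon> \<times> {0..L}) (D1 f)"
      by (rule continuous_on_subset[OF C_infinity_on_imp_continuous_on[OF smooth_periodic_familyD(1)[OF f1]]])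
        (use \<epsilon> in auto)
    have "continuous_on (ball t \<epsilon> \<times> {0..L}) (\<lambda>p. cis (- 2 * pi * of_int n * snd p / L))"
      unfolding cis_conv_exp divide_inverse by (intro continuous_intros)
    from continuous_on_mult[OF continuous_on_of_real[OF c1] this]
    show "continuous_on (ball t \<epsilon> \<times> cbox 0 L) (\<lambda>(s, x). of_real (D1 f (s, x)) * ?e x)"
      by (simp only: case_prod_beta' prod.collapse cbox_interval)
  qed (use \<epsilon> in auto)
  then have "((\<lambda>t. integral {0..L} (\<lambda>x. of_real (f (t, x)) * ?e x)) has_vector_derivative
      integral {0..L} (\<lambda>x. of_real (D1 f (t, x)) * ?e x)) (at t)"
    unfolding cbox_interval at_within_open[OF centre_in_ball[THEN iffD2, OF \<epsilon>(1)] open_ball] .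
  then have "((\<lambda>t. (1 / of_real L) * integral {0..L} (\<lambda>x. of_real (f (t, x)) * ?e x)) has_vector_derivative
      (1 / of_real L) * integral {0..L} (\<lambda>x. of_real (D1 f (t, x)) * ?e x)) (at t)"
    by (rule bounded_linear.has_vector_derivative[OF bounded_linear_mult_right])
  then have "((\<lambda>t. (1 / of_real L) * integral {0..L} (\<lambda>x. of_real (f (t, x)) * ?e x)) has_vector_derivative
      fourier_coeff L (\<lambda>x. D1 f (t, x)) n) (at t)"
    unfolding fourier_coeff_eq_integral[OF cont1[OF t]] .
  then show ?thesis
    by (rule has_vector_derivative_transform_within_open[OF _ I t])
      (rule fourier_coeff_eq_integral[symmetric], rule cont)
qed

lemma smooth_periodic_family_in_Hs_per:
  assumes L: "L > 0" and I: "open I" and f: "smooth_periodic_family L I f" and t: "t \<in> I"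
  shows "(\<lambda>x. f (t, x)) \<in> Hs_per L s"
proof -
  have c: "continuous_on UNIV (\<lambda>x. f (t, x))"
    by (rule smooth_periodic_family_continuous[OF f t])
  obtain M where "\<And>n. (1 + (of_int n)\<^sup>2) ^ Suc s * norm (fourier_coeff L (\<lambda>x. f (t, x)) n) \<le> M"
    using fourier_coeff_decay[OF L I f, of "{t}" "Suc s"] t by auto
  then have "(\<lambda>n. (1 + (of_int n)\<^sup>2) ^ s * (norm (fourier_coeff L (\<lambda>x. f (t, x)) n))\<^sup>2) summable_on UNIV"
    by (rule Hs_summable_of_decay)
  moreover have "(\<lambda>x. f (t, x)) \<in> borel_measurable lborel"
    using borel_measurable_continuous_onI[OF c] by simp
  then have "(\<lambda>x. f (t, x)) \<in> borel_measurable lebesgue"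
    by (rule measurable_completion)
  moreover have "set_integrable lebesgue {0..L} (\<lambda>x. (f (t, x))\<^sup>2)"
    by (intro absolutely_integrable_continuous_real continuous_intros continuous_on_subset[OF c] subset_UNIV)
  ultimately show ?thesis
    unfolding Hs_per_def using smooth_periodic_familyD(2)[OF f t] by blast
qed

text \<open>
Every Fourier coefficient \<open>a(t)\<close> of \<open>f (t, _)\<close> is twice differentiable in \<open>t\<close>, and \<open>a''\<close> is the coefficient of
the second parameter derivative of \<open>f\<close>, which is at most \<open>M / (1 + n\<^sup>2)\<^sup>s\<^sup>+\<^sup>1\<close> near \<open>t\<close>. Taylor's formula bounds
the coefficients of the difference quotient error by \<open>\<bar>h\<bar>\<close> times this. Taking
coefficients first reduces the claim to functions of \<open>t\<close> alone.
\<close>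

lemma smooth_periodic_family_has_Hs_derivative:
  assumes L: "L > 0" and I: "open I" and f: "smooth_periodic_family L I f" and t: "t \<in> I"
  shows "has_Hs_derivative L s (\<lambda>t x. f (t, x)) (\<lambda>x. D1 f (t, x)) t"
proof -
  have f1: "smooth_periodic_family L I (D1 f)"
    by (intro smooth_periodic_family_frechet_derivative I f)
  have f2: "smooth_periodic_family L I (D1 (D1 f))"
    by (intro smooth_periodic_family_frechet_derivative I f1)
  obtain \<epsilon> where \<epsilon>: "\<epsilon> > 0" "cball t \<epsilon> \<subseteq> I" using I t open_contains_cball by blast
  obtain M where M: "M \<ge> 0" "\<And>\<tau> n. \<tau> \<in> cball t \<epsilon> \<Longrightarrow>
      (1 + (of_int n)\<^sup>2) ^ Suc s * norm (fourier_coeff L (\<lambda>x. D1 (D1 f) (\<tau>, x)) n) \<le> M"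
    using fourier_coeff_decay[OF L I f2 compact_cball \<epsilon>(2), of "Suc s"] by blast
  define Z where "Z = sqrt (L * (\<Sum>\<^sub>\<infinity>n::int. 1 / (1 + (of_int n)\<^sup>2)))"
  \<comment> \<open>The constant \<open>Z\<close> converts a bound on weighted coefficients into one on the norm.\<close>
  have bound: "Hs_norm L s (\<lambda>x. (f (t + h, x) - f (t, x)) / h - D1 f (t, x)) \<le> (\<bar>h\<bar> * M) * Z"
    if h: "h \<noteq> 0" "\<bar>h\<bar> < \<epsilon>" for h
    unfolding Z_def
  proof (rule Hs_norm_le_of_decay[OF L])
    fix n
    let ?w = "(1 + (of_int n)\<^sup>2) ^ Suc s :: real"
    let ?a = "\<lambda>\<tau>. fourier_coeff L (\<lambda>x. f (\<tau>, x)) n" and ?b = "\<lambda>\<tau>. fourier_coeff L (\<lambda>x. D1 f (\<tau>, x)) n"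
      and ?c = "\<lambda>\<tau>. fourier_coeff L (\<lambda>x. D1 (D1 f) (\<tau>, x)) n"
    let ?S = "closed_segment t (t + h)"
    have S: "?S \<subseteq> cball t \<epsilon>"
      using h by (intro closed_segment_subset) (auto simp: dist_real_def)
    have w: "?w > 0" by (intro zero_less_power) (simp add: add_pos_nonneg)
    have b: "norm (?b \<tau> - ?b t) \<le> M / ?w * \<bar>h\<bar>" if \<tau>: "\<tau> \<in> ?S" for \<tau>
    proof -
      have "norm (?b \<tau> - ?b t) \<le> M / ?w * norm (\<tau> - t)"
      proof (rule differentiable_bound[of ?S ?b "\<lambda>\<tau> h. h *\<^sub>R ?c \<tau>"])
        show "(?b has_derivative (\<lambda>h. h *\<^sub>R ?c \<sigma>)) (at \<sigma> within ?S)" if "\<sigma> \<in> ?S" for \<sigma>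
          by (rule fourier_coeff_has_vector_derivative[OF L I f1, THEN has_vector_derivative_at_within,
                unfolded has_vector_derivative_def]) (use that S \<epsilon> in auto)
        show "onorm (\<lambda>h. h *\<^sub>R ?c \<sigma>) \<le> M / ?w" if "\<sigma> \<in> ?S" for \<sigma>
        proof (rule onorm_le)
          fix y
          have "norm (?c \<sigma>) \<le> M / ?w"
            using M(2)[of \<sigma> n] that S w by (simp add: pos_le_divide_eq mult.commute subset_iff del: power_Suc)
          then show "norm (y *\<^sub>R ?c \<sigma>) \<le> M / ?w * norm y"
            using mult_left_mono[of "norm (?c \<sigma>)" "M / ?w" "norm y"] by (simp add: mult.commute del: power_Suc)
        qed
      qed (use \<tau> in auto)
      also have "\<dots> \<le> M / ?w * \<bar>h\<bar>"
      proof (rule mult_left_mono)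
        show "norm (\<tau> - t) \<le> \<bar>h\<bar>"
          using \<tau> by (auto simp: closed_segment_eq_real_ivl split: if_splits)
        show "0 \<le> M / ?w" by (rule divide_nonneg_pos[OF M(1) w])
      qed
      finally show ?thesis .
    qed
    have "norm (?a (t + h) - ?a t - ((t + h) - t) *\<^sub>R ?b t) \<le> norm ((t + h) - t) * (M / ?w * \<bar>h\<bar>)"
    proof (rule vector_differentiable_bound_linearization[where S = ?S and f' = ?b and ?x0.0 = t])
      show "(?a has_vector_derivative ?b \<sigma>) (at \<sigma> within ?S)" if "\<sigma> \<in> ?S" for \<sigma>
        by (rule fourier_coeff_has_vector_derivative[OF L I f, THEN has_vector_derivative_at_within])
          (use that S \<epsilon> in auto)
    qed (use b in auto)
    then have a: "norm (?a (t + h) - ?a t - h *\<^sub>R ?b t) \<le> \<bar>h\<bar> * (M / ?w * \<bar>h\<bar>)" by simp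
    have th: "t + h \<in> I" using h \<epsilon> by (auto simp: dist_real_def subset_iff)
    note cont = continuous_on_subset[OF smooth_periodic_family_continuous subset_UNIV]
    have "fourier_coeff L (\<lambda>x. (f (t + h, x) - f (t, x)) / h - D1 f (t, x)) n
        = fourier_coeff L (\<lambda>x. (1 / h) * (1 * f (t + h, x) + (- 1) * f (t, x)) + (- 1) * D1 f (t, x)) n"
      by simp
    also have "\<dots> = of_real (1 / h) * fourier_coeff L (\<lambda>x. 1 * f (t + h, x) + (- 1) * f (t, x)) n
        + of_real (- 1) * ?b t"
      by (rule fourier_coeff_linear)
        (intro continuous_intros cont[OF f th] cont[OF f t] cont[OF f1 t])+
    also have "fourier_coeff L (\<lambda>x. 1 * f (t + h, x) + (- 1) * f (t, x)) n
        = of_real 1 * ?a (t + h) + of_real (- 1) * ?a t"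
      by (rule fourier_coeff_linear[OF cont[OF f th] cont[OF f t]])
    also have "of_real (1 / h) * (of_real 1 * ?a (t + h) + of_real (- 1) * ?a t) + of_real (- 1) * ?b t
        = (1 / h) *\<^sub>R (?a (t + h) - ?a t - h *\<^sub>R ?b t)"
      using h by (simp add: scaleR_conv_of_real field_simps)
    finally have "norm (fourier_coeff L (\<lambda>x. (f (t + h, x) - f (t, x)) / h - D1 f (t, x)) n)
        = (1 / \<bar>h\<bar>) * norm (?a (t + h) - ?a t - h *\<^sub>R ?b t)"
      by (simp only: norm_scaleR) simp
    also have "\<dots> \<le> (1 / \<bar>h\<bar>) * (\<bar>h\<bar> * (M / ?w * \<bar>h\<bar>))"
      by (intro mult_left_mono a) simp
    also have "\<dots> = (\<bar>h\<bar> * M) / ?w" using h by simp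
    finally show "?w * norm (fourier_coeff L (\<lambda>x. (f (t + h, x) - f (t, x)) / h - D1 f (t, x)) n) \<le> \<bar>h\<bar> * M"
      using w by (simp only: pos_le_divide_eq mult.commute)
  qed
  have "((\<lambda>h. Hs_norm L s (\<lambda>x. (f (t + h, x) - f (t, x)) / h - D1 f (t, x))) \<longlongrightarrow> 0) (at 0)"
  proof (rule tendsto_sandwich)
    show "\<forall>\<^sub>F h in at 0. 0 \<le> Hs_norm L s (\<lambda>x. (f (t + h, x) - f (t, x)) / h - D1 f (t, x))"
      unfolding Hs_norm_def using L by (auto intro!: always_eventually infsum_nonneg mult_nonneg_nonneg)
    show "\<forall>\<^sub>F h in at 0. Hs_norm L s (\<lambda>x. (f (t + h, x) - f (t, x)) / h - D1 f (t, x)) \<le> (\<bar>h\<bar> * M) * Z"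
      unfolding eventually_at using bound \<epsilon>(1) by (intro exI[of _ \<epsilon>]) (auto simp: dist_real_def)
    show "((\<lambda>h. (\<bar>h\<bar> * M) * Z) \<longlongrightarrow> 0) (at 0)"
      by (rule tendsto_eq_rhs, (rule tendsto_intros)+) simp
  qed simp
  then show ?thesis by (simp add: has_Hs_derivative_def)
qed

theorem smooth_periodic_family_imp_smooth_Hs_curve:
  assumes L: "L > 0" and I: "open I" and f: "smooth_periodic_family L I f"
  shows "smooth_Hs_curve_on L s (\<lambda>t x. f (t, x)) I"
proof -
  have D: "smooth_periodic_family L I ((D1 ^^ n) f)" for n
    by (induction n) (use f in \<open>auto intro: smooth_periodic_family_frechet_derivative[OF I]\<close>)
  show ?thesis
    unfolding smooth_Hs_curve_on_def
  proof (intro exI[of _ "\<lambda>n t x. (D1 ^^ n) f (t, x)"] conjI ballI allI)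
    show "(\<lambda>x. (D1 ^^ n) f (t, x)) \<in> Hs_per L s" if "t \<in> I" for n t
      by (rule smooth_periodic_family_in_Hs_per[OF L I D that])
    show "has_Hs_derivative L s (\<lambda>t x. (D1 ^^ n) f (t, x)) (\<lambda>x. (D1 ^^ Suc n) f (t, x)) t" if "t \<in> I" for n t
      using smooth_periodic_family_has_Hs_derivative[OF L I D that] by simp
  qed simp
qed

section \<open>Elliptic integrals as functions of amplitude and parameter\<close>

text \<open>
The case \<open>n = 0\<close> is the integrand of the elliptic integral of the first kind with parameter \<open>m = k\<^sup>2\<close>.
Differentiation in \<open>m\<close> maps the \<open>n\<close>-th member to a multiple of the next one. The parameter ranges over
\<open>m < 1\<close>, which puts the limiting value \<open>m = 0\<close> into the interior.
\<close>

definition ell_kernel :: "nat \<Rightarrow> real \<Rightarrow> real \<Rightarrow> real" where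
  "ell_kernel n m t = (sin t)\<^sup>2 ^ n * (1 - m * (sin t)\<^sup>2) powr (- (1/2) - n)"

definition ell_int :: "nat \<Rightarrow> real \<times> real \<Rightarrow> real" where
  "ell_int n = (\<lambda>(m, \<theta>). LBINT t=0..\<theta>. ell_kernel n m t)"

lemma m_sin_sq_less_1:
  fixes m :: real
  assumes "m < 1"
  shows "m * (sin t)\<^sup>2 < 1"
proof (cases "m \<le> 0")
  case True
  then show ?thesis using mult_nonpos_nonneg[of m "(sin t)\<^sup>2"] by simp
next
  case False
  have "m * (sin t)\<^sup>2 \<le> m * 1"
    using False abs_square_le_1[of "sin t"] by (intro mult_left_mono) auto
  then show ?thesis using assms by simp
qed

lemma C_infinity_on_ell_kernel: "C_infinity_on (\<lambda>(m, t). ell_kernel n m t) ({..<1} \<times> UNIV)"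
proof -
  have o: "open ({..<1::real} \<times> (UNIV :: real set))" by (simp add: open_Times)
  show ?thesis
    unfolding ell_kernel_def case_prod_beta'
    by (intro C_infinity_on_intros o) (auto simp: m_sin_sq_less_1)
qed

lemma continuous_on_ell_kernel: "m < 1 \<Longrightarrow> continuous_on S (ell_kernel n m)"
  using continuous_on_compose2[OF C_infinity_on_imp_continuous_on[OF C_infinity_on_ell_kernel],
      OF continuous_on_Pair[OF continuous_on_const continuous_on_id], of m S n]
  by auto

lemma ell_kernel_deriv_m:
  assumes "m < 1"
  shows "((\<lambda>m. ell_kernel n m t) has_real_derivative (real n + 1/2) * ell_kernel (Suc n) m t) (at m)"
proof -
  have pos: "1 - m * (sin t)\<^sup>2 > 0" using m_sin_sq_less_1[OF assms] by simp
  have "((\<lambda>m. 1 - m * (sin t)\<^sup>2) has_real_derivative - (sin t)\<^sup>2) (at m)"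
    by (auto intro!: derivative_eq_intros)
  from DERIV_cmult[OF DERIV_fun_powr[OF this pos, of "- (1/2) - n"], of "(sin t)\<^sup>2 ^ n"]
  show ?thesis
    by (simp add: ell_kernel_def algebra_simps)
qed

lemma ell_int_deriv_\<theta>:
  assumes "m < 1"
  shows "((\<lambda>\<theta>. ell_int n (m, \<theta>)) has_real_derivative ell_kernel n m \<theta>) (at \<theta>)"
proof -
  define R where "R = \<bar>\<theta>\<bar> + 1"
  have R: "- R < \<theta>" "\<theta> < R" "-R \<le> 0" "0 \<le> R" by (auto simp: R_def)
  have "((\<lambda>u. LBINT y=0..u. ell_kernel n m y) has_vector_derivative ell_kernel n m \<theta>) (at \<theta> within {-R..R})"
    using interval_integral_FTC2[OF R(3,4) continuous_on_ell_kernel[OF assms], of \<theta> n] R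
    by (simp add: zero_ereal_def)
  then show ?thesis
    using R at_within_Icc_at[OF R(1,2)]
    by (simp add: has_real_derivative_iff_has_vector_derivative ell_int_def)
qed

lemma ell_int_0 [simp]: "ell_int n (m, 0) = 0"
  by (simp add: ell_int_def zero_ereal_def)

lemma integral_ell_kernel_deriv_m:
  assumes "m < 1"
  shows "((\<lambda>m. integral {a..b} (ell_kernel n m)) has_real_derivative
    (real n + 1/2) * integral {a..b} (ell_kernel (Suc n) m)) (at m)"
proof -
  have "((\<lambda>m. integral (cbox a b) (ell_kernel n m)) has_vector_derivative
    integral (cbox a b) (\<lambda>t. (real n + 1/2) * ell_kernel (Suc n) m t)) (at m within {..<1})"
  proof (rule leibniz_rule_vector_derivative)
    show "((\<lambda>m. ell_kernel n m t) has_vector_derivative (real n + 1/2) * ell_kernel (Suc n) \<mu> t)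
        (at \<mu> within {..<1})" if "\<mu> \<in> {..<1}" for \<mu> t
      using ell_kernel_deriv_m[of \<mu> n t] that
      by (auto simp: has_real_derivative_iff_has_vector_derivative intro: has_vector_derivative_at_within)
    show "ell_kernel n \<mu> integrable_on cbox a b" if "\<mu> \<in> {..<1}" for \<mu>
      using that by (auto intro!: integrable_continuous_interval continuous_on_ell_kernel)
    have "continuous_on ({..<1} \<times> cbox a b) (\<lambda>(m, t). ell_kernel (Suc n) m t)"
      by (rule continuous_on_subset[OF C_infinity_on_imp_continuous_on[OF C_infinity_on_ell_kernel]]) auto
    then show "continuous_on ({..<1} \<times> cbox a b) (\<lambda>(m, t). (real n + 1/2) * ell_kernel (Suc n) m t)"
      unfolding case_prod_beta' by (intro continuous_intros)
  qed (use assms in auto)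
  then show ?thesis
    using assms by (simp add: has_real_derivative_iff_has_vector_derivative at_within_open[of m "{..<1}"])
qed

lemma ell_int_eq_integral:
  assumes "m < 1"
  shows "ell_int n (m, \<theta>) = integral {0..\<theta>} (ell_kernel n m) - integral {\<theta>..0} (ell_kernel n m)"
proof (cases "0 \<le> \<theta>")
  case True
  have "(LBINT t=0..\<theta>. ell_kernel n m t) = integral {0..\<theta>} (ell_kernel n m)"
    using interval_integral_eq_integral[OF True borel_integrable_atLeastAtMost'[OF continuous_on_ell_kernel[OF assms]], of n]
    by (simp add: zero_ereal_def)
  moreover have "integral {\<theta>..0} (ell_kernel n m) = 0"
    using True by (cases "\<theta> = 0") auto
  ultimately show ?thesis by (simp add: ell_int_def)
next
  case False
  then have "(LBINT t=\<theta>..0. ell_kernel n m t) = integral {\<theta>..0} (ell_kernel n m)"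
    using interval_integral_eq_integral[OF _ borel_integrable_atLeastAtMost'[OF continuous_on_ell_kernel[OF assms]], of \<theta> 0 n]
    by (simp add: zero_ereal_def)
  then show ?thesis
    using False interval_integral_endpoints_reverse[of 0 \<theta> "ell_kernel n m"] by (simp add: ell_int_def)
qed

lemma ell_int_deriv_m:
  assumes "m < 1"
  shows "((\<lambda>m. ell_int n (m, \<theta>)) has_real_derivative (real n + 1/2) * ell_int (Suc n) (m, \<theta>)) (at m)"
proof -
  have "((\<lambda>m. integral {0..\<theta>} (ell_kernel n m) - integral {\<theta>..0} (ell_kernel n m)) has_real_derivative
      (real n + 1/2) * ell_int (Suc n) (m, \<theta>)) (at m)"
    unfolding ell_int_eq_integral[OF assms] right_diff_distrib
    by (intro DERIV_diff integral_ell_kernel_deriv_m assms)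
  then show ?thesis
  proof (rule has_field_derivative_transform_within_open)
    show "integral {0..\<theta>} (ell_kernel n \<mu>) - integral {\<theta>..0} (ell_kernel n \<mu>) = ell_int n (\<mu>, \<theta>)"
      if "\<mu> \<in> {..<1}" for \<mu>
      using that by (simp add: ell_int_eq_integral)
  qed (use assms in auto)
qed

text \<open>
The amplitude derivative is jointly continuous, being an explicit function; this and the mere existence of
the parameter derivative give total differentiability.
\<close>

lemma ell_int_has_derivative:
  assumes "m < 1"
  shows "(ell_int n has_derivative
    (\<lambda>(u, v). (real n + 1/2) * ell_int (Suc n) (m, \<theta>) * u + ell_kernel n m \<theta> * v)) (at (m, \<theta>))"
proof -
  have o: "open ({..<1::real} \<times> (UNIV :: real set))" by (simp add: open_Times)
  have "((\<lambda>(m, \<theta>). ell_int n (m, \<theta>)) has_derivative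
      (\<lambda>(u, v). (real n + 1/2) * ell_int (Suc n) (m, \<theta>) * u + blinfun_mult_right (ell_kernel n m \<theta>) v))
      (at (m, \<theta>) within {..<1} \<times> UNIV)"
  proof (rule has_derivative_partialsI)
    show "((\<lambda>m. ell_int n (m, \<theta>)) has_derivative (*) ((real n + 1/2) * ell_int (Suc n) (m, \<theta>))) (at m within {..<1})"
      using ell_int_deriv_m[OF assms] by (auto simp: has_field_derivative_def intro: has_derivative_at_withinI)
    show "((\<lambda>\<theta>. ell_int n (\<mu>, \<theta>)) has_derivative blinfun_mult_right (ell_kernel n \<mu> \<theta>)) (at \<theta> within UNIV)"
      if "\<mu> \<in> {..<1}" for \<mu> \<theta>
      using ell_int_deriv_\<theta>[of \<mu> n \<theta>] that by (simp add: has_field_derivative_def)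
    have "continuous (at (m, \<theta>)) (\<lambda>(m, \<theta>). ell_kernel n m \<theta>)"
      using C_infinity_on_imp_continuous_on[OF C_infinity_on_ell_kernel] o assms
      by (auto simp: continuous_on_eq_continuous_at)
    then have "continuous (at (m, \<theta>)) (\<lambda>p. blinfun_mult_right ((\<lambda>(m, \<theta>). ell_kernel n m \<theta>) p))"
      by (rule bounded_linear.continuous[OF bounded_linear_blinfun_mult_right])
    then show "continuous (at (m, \<theta>) within {..<1} \<times> UNIV) (\<lambda>(m, \<theta>). blinfun_mult_right (ell_kernel n m \<theta>))"
      by (simp add: case_prod_beta' continuous_at_imp_continuous_at_within)
  qed auto
  then show ?thesis
    using assms by (simp add: at_within_open[OF _ o])
qed

text \<open>
The induction on the order is over all \<open>n\<close> at once: the partial derivatives of the \<open>n\<close>-th integral are a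
multiple of integral \<open>n + 1\<close> and an explicit smooth function.
\<close>

lemma C_infinity_on_ell_int: "C_infinity_on (ell_int n) ({..<1} \<times> UNIV)"
proof -
  let ?S = "{..<1::real} \<times> (UNIV :: real set)"
  have o: "open ?S" by (simp add: open_Times)
  have "C_diff_on N (ell_int n) ?S" for N
  proof (induction N arbitrary: n)
    case 0
    have "isCont (ell_int n) p" if "p \<in> ?S" for p
      using that ell_int_has_derivative[of "fst p" n "snd p"]
      by (cases p) (auto intro: has_derivative_continuous)
    then show ?case by (simp add: continuous_at_imp_continuous_on)
  next
    case (Suc N)
    let ?D = "\<lambda>p v. (real n + 1/2) * ell_int (Suc n) p * fst v + ell_kernel n (fst p) (snd p) * snd v"
    show ?case
    proof (rule C_diff_on_SucI[OF o, where f' = ?D])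
      show "(ell_int n has_derivative ?D p) (at p)" if "p \<in> ?S" for p
        using that ell_int_has_derivative[of "fst p" n "snd p"] by (simp add: case_prod_beta' mem_Times_iff)
      have *: "C_diff_on N (\<lambda>p. c * f p) ?S" if "C_diff_on N f ?S" for c :: real and f
        by (rule C_diff_on_bounded_linear[OF bounded_linear_mult_right o that])
      have k: "C_diff_on N (\<lambda>p. ell_kernel n (fst p) (snd p)) ?S"
        using C_infinity_on_ell_kernel[of n] by (simp add: C_infinity_on_def case_prod_beta')
      show "C_diff_on N (\<lambda>p. ?D p v) ?S" for v
        using C_diff_on_add[OF o *[OF Suc, of "(real n + 1/2) * fst v" "Suc n"] *[OF k, of "snd v"]]
        by (simp add: mult_ac)
    qed
  qed
  then show ?thesis by (simp add: C_infinity_on_def)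
qed

section \<open>The complete elliptic integral\<close>

definition ell_K :: "real \<Rightarrow> real" where
  "ell_K m = ell_int 0 (m, pi / 2)"

lemma ell_kernel_0: "m < 1 \<Longrightarrow> ell_kernel 0 m t = 1 / sqrt (1 - m * (sin t)\<^sup>2)"
proof -
  assume "m < 1"
  then have X: "0 \<le> 1 - m * (sin t)\<^sup>2" using m_sin_sq_less_1[of m t] by simp
  have "ell_kernel 0 m t = (1 - m * (sin t)\<^sup>2) powr - (1/2)" by (simp add: ell_kernel_def)
  also have "\<dots> = 1 / sqrt (1 - m * (sin t)\<^sup>2)"
    unfolding powr_minus powr_half_sqrt[OF X] by (rule inverse_eq_divide)
  finally show ?thesis .
qed

lemma modulus_square_less_1: "k \<in> {0<..<1} \<Longrightarrow> k\<^sup>2 < (1 :: real)"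
  by (simp add: abs_square_less_1)

lemma elliptic_F_eq: "k\<^sup>2 < 1 \<Longrightarrow> elliptic_F \<theta> k = ell_int 0 (k\<^sup>2, \<theta>)"
proof -
  assume "k\<^sup>2 < 1"
  then have "ell_kernel 0 (k\<^sup>2) = (\<lambda>t. 1 / sqrt (1 - k\<^sup>2 * (sin t)\<^sup>2))"
    by (intro ext ell_kernel_0)
  then show ?thesis by (simp only: elliptic_F_def ell_int_def prod.case)
qed

lemma elliptic_K_eq: "k\<^sup>2 < 1 \<Longrightarrow> elliptic_K k = ell_K (k\<^sup>2)"
  by (simp add: elliptic_K_def elliptic_F_eq ell_K_def)

lemma ell_kernel_0_pos: "m < 1 \<Longrightarrow> ell_kernel 0 m t > 0"
  by (simp add: ell_kernel_0 m_sin_sq_less_1)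

lemma ell_kernel_0_ge_1: "0 \<le> m \<Longrightarrow> m < 1 \<Longrightarrow> ell_kernel 0 m t \<ge> 1"
  using m_sin_sq_less_1[of m t] by (simp add: ell_kernel_0)

lemma ell_int_0_strict_mono:
  assumes "m < 1" "x < y"
  shows "ell_int 0 (m, x) < ell_int 0 (m, y)"
  using DERIV_pos_imp_increasing[OF assms(2), of "\<lambda>\<theta>. ell_int 0 (m, \<theta>)"]
    ell_int_deriv_\<theta>[OF assms(1)] ell_kernel_0_pos[OF assms(1)] by blast

lemma ell_K_pos: "m < 1 \<Longrightarrow> ell_K m > 0"
  using ell_int_0_strict_mono[of m 0 "pi/2"] by (simp add: ell_K_def)

text \<open>
Gives \<open>\<bar>F(\<theta>)\<bar> \<ge> \<bar>\<theta>\<bar>\<close> for the elliptic integral \<open>F\<close>, and hence its surjectivity.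
\<close>

lemma ell_int_minus_id_mono:
  assumes "0 \<le> m" "m < 1" "x \<le> y"
  shows "ell_int 0 (m, x) - x \<le> ell_int 0 (m, y) - y"
proof (rule DERIV_nonneg_imp_nondecreasing[OF assms(3)])
  fix t
  have "((\<lambda>\<theta>. ell_int 0 (m, \<theta>) - \<theta>) has_real_derivative ell_kernel 0 m t - 1) (at t)"
    using ell_int_deriv_\<theta>[OF assms(2)] by (auto intro!: derivative_eq_intros)
  then show "\<exists>D. ((\<lambda>\<theta>. ell_int 0 (m, \<theta>) - \<theta>) has_real_derivative D) (at t) \<and> 0 \<le> D"
    using ell_kernel_0_ge_1[OF assms(1,2), of t] by auto
qed

lemma ell_int_surj:
  assumes "0 \<le> m" "m < 1"
  shows "\<exists>\<theta>. ell_int 0 (m, \<theta>) = u"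
proof -
  have cont: "isCont (\<lambda>\<theta>. ell_int 0 (m, \<theta>)) x" for x
    using ell_int_deriv_\<theta>[OF assms(2)] by (rule DERIV_isCont)
  show ?thesis
  proof (cases "u \<ge> 0")
    case True
    then show ?thesis
      using IVT[of "\<lambda>\<theta>. ell_int 0 (m, \<theta>)" 0 u u] cont ell_int_minus_id_mono[OF assms True] by auto
  next
    case False
    then show ?thesis
      using IVT[of "\<lambda>\<theta>. ell_int 0 (m, \<theta>)" u u 0] cont ell_int_minus_id_mono[OF assms, of u 0] by auto
  qed
qed

lemma ell_int_odd:
  assumes "m < 1"
  shows "ell_int 0 (m, - \<theta>) = - ell_int 0 (m, \<theta>)"
proof -
  have "((\<lambda>\<theta>. ell_int 0 (m, \<theta>) + ell_int 0 (m, - \<theta>)) has_real_derivative 0) (at t)" for t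
  proof -
    have "((\<lambda>\<theta>. ell_int 0 (m, - \<theta>)) has_real_derivative ell_kernel 0 m (- t) * - 1) (at t)"
      by (rule DERIV_chain2[OF ell_int_deriv_\<theta>[OF assms]]) (auto intro!: derivative_eq_intros)
    from DERIV_add[OF ell_int_deriv_\<theta>[OF assms, of 0 t] this]
    show ?thesis by (simp add: ell_kernel_def)
  qed
  from DERIV_isconst_all[OF allI[OF this], of \<theta> 0] show ?thesis by simp
qed

lemma ell_int_add_pi:
  assumes "m < 1"
  shows "ell_int 0 (m, \<theta> + pi) = ell_int 0 (m, \<theta>) + 2 * ell_K m"
proof -
  have "((\<lambda>\<theta>. ell_int 0 (m, \<theta> + pi) - ell_int 0 (m, \<theta>)) has_real_derivative 0) (at t)" for t
  proof -
    have "((\<lambda>\<theta>. ell_int 0 (m, \<theta> + pi)) has_real_derivative ell_kernel 0 m (t + pi) * 1) (at t)"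
      by (rule DERIV_chain2[OF ell_int_deriv_\<theta>[OF assms]]) (auto intro!: derivative_eq_intros)
    from DERIV_diff[OF this ell_int_deriv_\<theta>[OF assms, of 0 t]]
    show ?thesis by (simp add: ell_kernel_def)
  qed
  \<comment> \<open>The constant is found at \<open>- \<pi> / 2\<close>, where oddness gives \<open>2 K\<close>.\<close>
  from DERIV_isconst_all[OF allI[OF this], of \<theta> "- (pi/2)"] show ?thesis
    using ell_int_odd[OF assms, of "pi/2"] by (simp add: ell_K_def)
qed

lemma ell_K_0: "ell_K 0 = pi / 2"
proof -
  have "((\<lambda>\<theta>. ell_int 0 (0, \<theta>) - \<theta>) has_real_derivative 0) (at t)" for t
    using ell_int_deriv_\<theta>[of 0 0] by (auto intro!: derivative_eq_intros simp: ell_kernel_def)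
  from DERIV_isconst_all[OF allI[OF this], of "pi/2" 0] show ?thesis by (simp add: ell_K_def)
qed

lemma ell_K_deriv: "m < 1 \<Longrightarrow> (ell_K has_real_derivative ell_int 1 (m, pi/2) / 2) (at m)"
  using ell_int_deriv_m[of m 0 "pi/2"] unfolding ell_K_def[abs_def] by simp

text \<open>
Integrating \<open>d/dt (sin t cos t / \<Delta>) = (cos\<^sup>2 t - sin\<^sup>2 t) / \<Delta> + m sin\<^sup>2 t cos\<^sup>2 t / \<Delta>\<^sup>3\<close> with
\<open>\<Delta> = \<surd>(1 - m sin\<^sup>2 t)\<close> over \<open>[0, \<pi>/2]\<close> shows that \<open>sin\<^sup>2\<close> has mean at least \<open>1/2\<close> for the weight \<open>1 / \<Delta>\<close>, and
\<open>2 dK/dm\<close> is the integral of \<open>sin\<^sup>2 t / \<Delta>\<^sup>3 \<ge> sin\<^sup>2 t / \<Delta>\<close>. The proof compares the antiderivatives.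
\<close>

lemma ell_K_deriv_ge:
  assumes "0 \<le> m" "m < 1"
  shows "ell_int 1 (m, pi/2) / 2 \<ge> ell_K m / 4"
proof -
  \<comment> \<open>The last term vanishes at \<open>0\<close> and at \<open>\<pi> / 2\<close>; it makes the derivative nonnegative pointwise.\<close>
  let ?H = "\<lambda>t. 2 * ell_int 1 (m, t) - ell_int 0 (m, t) + sin t * cos t * ell_kernel 0 m t"
  have "?H 0 \<le> ?H (pi / 2)"
  proof (rule DERIV_nonneg_imp_nondecreasing[of 0 "pi / 2" ?H])
    fix t
    define X where "X = 1 - m * (sin t)\<^sup>2"
    define Y where "Y = X powr (- (3/2))"
    have X: "X > 0" using m_sin_sq_less_1[OF assms(2)] by (simp add: X_def)
    have k: "ell_kernel 0 m t = X * Y" "ell_kernel 1 m t = (sin t)\<^sup>2 * Y"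
      using X powr_mult_base[of X "-(3/2)"] by (simp_all add: ell_kernel_def X_def[symmetric] Y_def)
    have "((\<lambda>t. 1 - m * (sin t)\<^sup>2) has_real_derivative - 2 * m * sin t * cos t) (at t)"
      by (auto intro!: derivative_eq_intros)
    from DERIV_fun_powr[OF this, of "- (1/2)"] X
    have dk: "(ell_kernel 0 m has_real_derivative m * sin t * cos t * Y) (at t)"
      unfolding Y_def ell_kernel_def by (simp add: X_def[symmetric] mult_ac)
    have "(?H has_real_derivative
       2 * ell_kernel 1 m t - ell_kernel 0 m t
        + ((cos t * cos t - sin t * sin t) * ell_kernel 0 m t + sin t * cos t * (m * sin t * cos t * Y))) (at t)"
      using ell_int_deriv_\<theta>[OF assms(2), of 1 t] ell_int_deriv_\<theta>[OF assms(2), of 0 t] dk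
      by (auto intro!: derivative_eq_intros)
    moreover have "2 * ell_kernel 1 m t - ell_kernel 0 m t
        + ((cos t * cos t - sin t * sin t) * ell_kernel 0 m t + sin t * cos t * (m * sin t * cos t * Y))
        = m * (sin t)\<^sup>2 * (1 + (sin t)\<^sup>2) * Y"
    proof -
      define z where "z = (sin t)\<^sup>2"
      have c: "cos t * cos t = 1 - z" "sin t * sin t = z"
        using sin_cos_squared_add[of t] by (simp_all add: z_def power2_eq_square algebra_simps)
      have "sin t * cos t * (m * sin t * cos t * Y) = m * (sin t * sin t) * (cos t * cos t) * Y"
        by (simp only: mult_ac)
      then show ?thesis
        unfolding k c z_def[symmetric] X_def by (simp add: algebra_simps)
    qed
    moreover have "m * (sin t)\<^sup>2 * (1 + (sin t)\<^sup>2) * Y \<ge> 0"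
      using assms by (simp add: Y_def)
    ultimately show "\<exists>D. (?H has_real_derivative D) (at t) \<and> 0 \<le> D" by auto
  qed simp
  then show ?thesis by (simp add: ell_K_def)
qed

text \<open>
With \<open>e = \<surd>(1 - m)\<close> the bounds \<open>1 - m sin\<^sup>2 t \<le> e\<^sup>2 + cos\<^sup>2 t \<le> (e + \<pi>/2 - t)\<^sup>2\<close> show that the integrand
dominates \<open>1 / (e + \<pi>/2 - t)\<close>.
\<close>

lemma ell_K_ge_ln:
  assumes "0 \<le> m" "m < 1"
  shows "ell_K m \<ge> ln (pi / 2) - ln (sqrt (1 - m))"
proof -
  define e where "e = sqrt (1 - m)"
  have e: "e > 0" using assms by (simp add: e_def)
  let ?H = "\<lambda>t. ell_int 0 (m, t) + ln (e + pi / 2 - t)"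
  have "?H 0 \<le> ?H (pi / 2)"
  proof (rule DERIV_nonneg_imp_nondecreasing[of 0 "pi / 2" ?H])
    fix t :: real assume t: "0 \<le> t" "t \<le> pi / 2"
    have "(?H has_real_derivative ell_kernel 0 m t + 1 / (e + pi / 2 - t) * (-1)) (at t)"
      using ell_int_deriv_\<theta>[OF assms(2), of 0 t] e t by (auto intro!: derivative_eq_intros)
    moreover have "1 / (e + pi / 2 - t) \<le> ell_kernel 0 m t"
    proof -
      have c: "0 \<le> cos t" "cos t \<le> pi / 2 - t"
        using t sin_x_le_x[of "pi / 2 - t"] cos_ge_zero[of t] by (auto simp: cos_sin_eq)
      have "1 - m * (sin t)\<^sup>2 \<le> e\<^sup>2 + (cos t)\<^sup>2"
        using assms mult_right_mono[of m 1 "(cos t)\<^sup>2"] by (simp add: e_def sin_squared_eq algebra_simps)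
      also have "\<dots> \<le> (e + cos t)\<^sup>2" using e c by (simp add: power2_sum)
      finally have "sqrt (1 - m * (sin t)\<^sup>2) \<le> e + cos t"
        using e c by (intro real_le_lsqrt) auto
      then have "sqrt (1 - m * (sin t)\<^sup>2) \<le> e + pi / 2 - t" using c by linarith
      then show ?thesis
        using m_sin_sq_less_1[OF assms(2), of t] assms
        by (simp add: ell_kernel_0 frac_le)
    qed
    ultimately show "\<exists>D. (?H has_real_derivative D) (at t) \<and> 0 \<le> D"
      by force
  qed simp
  moreover have "ln (pi / 2) \<le> ln (e + pi / 2)" using e by (subst ln_le_cancel_iff) (auto simp: add_pos_pos)
  ultimately show ?thesis by (simp add: ell_K_def e_def)
qed

section \<open>Monotonicity in the parameter\<close>

definition quad_root :: "real \<Rightarrow> real" where "quad_root m = sqrt (m\<^sup>2 - m + 1)"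

lemma quad_pos: "m\<^sup>2 - m + 1 > (0::real)"
proof -
  have "m\<^sup>2 - m + 1 = (m - 1/2)\<^sup>2 + 3/4" by (simp add: power2_eq_square algebra_simps)
  then show ?thesis using zero_le_power2[of "m - 1/2"] by linarith
qed

lemma quad_root_pos: "quad_root m > 0" and quad_root_sq: "(quad_root m)\<^sup>2 = m\<^sup>2 - m + 1"
  using quad_pos[of m] by (simp_all add: quad_root_def)

lemma quad_root_less_1: "0 < m \<Longrightarrow> m < 1 \<Longrightarrow> quad_root m < 1"
  by (simp add: quad_root_def power2_eq_square)

lemma quad_root_deriv: "(quad_root has_real_derivative (2 * m - 1) / (2 * quad_root m)) (at m)"
  unfolding quad_root_def[abs_def] using quad_pos[of m]
  by (auto intro!: derivative_eq_intros simp: divide_simps)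

text \<open>
The wave frequency in terms of the parameter \<open>m = k\<^sup>2\<close>, up to the factor \<open>16 / L\<^sup>2\<close>.
\<close>

definition freq :: "real \<Rightarrow> real" where "freq m = (ell_K m)\<^sup>2 * quad_root m"

lemma freq_deriv:
  assumes "m < 1"
  shows "(freq has_real_derivative
    ell_K m * ell_int 1 (m, pi/2) * quad_root m + (ell_K m)\<^sup>2 * ((2 * m - 1) / (2 * quad_root m))) (at m)"
  unfolding freq_def[abs_def]
  by (rule derivative_eq_intros ell_K_deriv[OF assms] quad_root_deriv refl)+ simp

text \<open>
By \<open>dK/dm \<ge> K/4\<close> and \<open>r\<^sup>2 = m\<^sup>2 - m + 1\<close> the derivative is at least \<open>K\<^sup>2 (m + m\<^sup>2) / (2 r)\<close>.
\<close>

lemma freq_deriv_pos: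
  assumes "0 < m" "m < 1"
  shows "ell_K m * ell_int 1 (m, pi/2) * quad_root m + (ell_K m)\<^sup>2 * ((2 * m - 1) / (2 * quad_root m)) > 0"
proof -
  let ?K = "ell_K m" and ?r = "quad_root m"
  have K: "?K > 0" and r: "?r > 0" using assms ell_K_pos quad_root_pos by auto
  have "0 < m + m\<^sup>2" using assms by (simp add: add_pos_pos)
  then have "0 < ?K\<^sup>2 * ((m + m\<^sup>2) / (2 * ?r))"
    using K r by (intro mult_pos_pos divide_pos_pos) auto
  also have "\<dots> = ?K * (?K / 2) * ?r + ?K\<^sup>2 * ((2 * m - 1) / (2 * ?r))"
  proof -
    have "?K * (?K / 2) * ?r = ?K\<^sup>2 * (?r\<^sup>2 / (2 * ?r))"
      using r by (simp add: power2_eq_square)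
    also have "\<dots> = ?K\<^sup>2 * ((m\<^sup>2 - m + 1) / (2 * ?r))"
      unfolding quad_root_sq ..
    finally show ?thesis
      by (simp only: distrib_left[symmetric] add_divide_distrib[symmetric]) (simp add: algebra_simps)
  qed
  also have "?K * (?K / 2) * ?r \<le> ?K * ell_int 1 (m, pi/2) * ?r"
    using ell_K_deriv_ge[of m] assms K r by (intro mult_right_mono mult_left_mono) auto
  finally show ?thesis by simp
qed

lemma freq_strict_mono:
  assumes "0 \<le> x" "x < y" "y < 1"
  shows "freq x < freq y"
proof (rule DERIV_pos_imp_increasing_open[OF assms(2)])
  show "continuous_on {x..y} freq"
    using assms by (intro continuous_at_imp_continuous_on ballI DERIV_isCont[OF freq_deriv]) auto
  show "\<exists>D. (freq has_real_derivative D) (at m) \<and> 0 < D" if "x < m" "m < y" for m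
    using assms that freq_deriv[of m] freq_deriv_pos[of m] by (intro exI conjI) auto
qed

lemma freq_0: "freq 0 = pi\<^sup>2 / 4"
  by (simp add: freq_def ell_K_0 quad_root_def power_divide)

lemma freq_unbounded:
  obtains m where "0 < m" "m < 1" "freq m > C"
proof -
  \<comment> \<open>With \<open>m = 1 - exp (- 2 D)\<close> the logarithmic bound gives \<open>K \<ge> D\<close>, and \<open>D\<^sup>2 / 2 \<ge> D > C\<close> as \<open>D \<ge> 2\<close>.\<close>
  define D where "D = max C 1 * 2"
  define e where "e = exp (- D)"
  have D: "D \<ge> 2" by (simp add: D_def)
  have e: "0 < e" "e < 1" using D by (auto simp: e_def)
  define m where "m = 1 - e\<^sup>2"
  have e2: "0 < e\<^sup>2" "e\<^sup>2 < 1" using e by (auto simp: power_less_one_iff abs_square_less_1)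
  have m: "0 < m" "m < 1" using e2 by (auto simp: m_def)
  have "ln (sqrt (1 - m)) = - D" using e by (simp add: m_def) (simp add: e_def)
  moreover have "ln (pi / 2) \<ge> 0" by (rule ln_ge_zero) (use pi_ge_two in simp)
  ultimately have K: "ell_K m \<ge> D" using ell_K_ge_ln[of m] m by linarith
  have "quad_root m \<ge> 1 / 2"
    unfolding quad_root_def
  proof (rule real_le_rsqrt)
    have "m\<^sup>2 - m + 1 = (m - 1/2)\<^sup>2 + 3/4" by (simp add: power2_eq_square algebra_simps)
    then show "(1/2)\<^sup>2 \<le> m\<^sup>2 - m + 1" using zero_le_power2[of "m - 1/2"] by (simp add: power2_eq_square)
  qed
  moreover have "(ell_K m)\<^sup>2 \<ge> D\<^sup>2" using K D by (intro power_mono) auto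
  ultimately have "freq m \<ge> D\<^sup>2 * (1/2)"
    unfolding freq_def by (intro mult_mono) auto
  moreover have "D\<^sup>2 * (1/2) > C"
  proof -
    have "D\<^sup>2 \<ge> D * 2" using D by (simp add: power2_eq_square)
    moreover have "D > C" by (simp add: D_def max_def)
    ultimately show ?thesis by linarith
  qed
  ultimately show ?thesis using that[of m] m by simp
qed

text \<open>
The left-hand side equals \<open>\<pi>\<^sup>2\<close> at \<open>m = 0\<close> and increases: by \<open>dK/dm \<ge> K/4\<close> its derivative is at least
\<open>K\<^sup>2 ((m + m\<^sup>2) / r - m / 2)\<close>, which is positive because \<open>r < 1\<close>.
\<close>

lemma amplitude_gt:
  assumes "0 < m" "m < 1"
  shows "(2 - m + 2 * quad_root m) * (ell_K m)\<^sup>2 > pi\<^sup>2"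
proof -
  let ?f = "\<lambda>m. (2 - m + 2 * quad_root m) * (ell_K m)\<^sup>2"
  let ?D = "\<lambda>m. (- 1 + (2 * m - 1) / quad_root m) * (ell_K m)\<^sup>2
      + (2 - m + 2 * quad_root m) * (ell_K m * ell_int 1 (m, pi/2))"
  have d: "(?f has_real_derivative ?D x) (at x)" if "x < 1" for x
    by (rule derivative_eq_intros ell_K_deriv[OF that] quad_root_deriv refl)+
      (use quad_root_pos[of x] in \<open>simp add: field_simps\<close>)
  have pos: "?D x > 0" if x: "0 < x" "x < 1" for x
  proof -
    let ?K = "ell_K x" and ?r = "quad_root x"
    have K: "?K > 0" and r: "?r > 0" "?r < 1" using x ell_K_pos quad_root_pos quad_root_less_1 by auto
    have "x + x\<^sup>2 \<le> (x + x\<^sup>2) / ?r"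
      using r x mult_left_le[of ?r "x + x\<^sup>2"] by (simp add: pos_le_divide_eq)
    then have "0 < - x / 2 + (x + x\<^sup>2) / ?r"
      using x(1) zero_le_power2[of x] by linarith
    then have "0 < ?K\<^sup>2 * (- x / 2 + (x + x\<^sup>2) / ?r)"
      using K by (intro mult_pos_pos) auto
    also have "\<dots> = (- 1 + (2 * x - 1) / ?r) * ?K\<^sup>2 + (2 - x + 2 * ?r) * (?K * (?K / 2))"
    proof -
      have "?r = ?r\<^sup>2 / ?r" using r by (simp add: power2_eq_square)
      then have "?r = (x\<^sup>2 - x + 1) / ?r" unfolding quad_root_sq .
      then have "(2 * x - 1) / ?r + ?r = (2 * x - 1) / ?r + (x\<^sup>2 - x + 1) / ?r"
        by (rule arg_cong)
      also have "\<dots> = (x + x\<^sup>2) / ?r"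
        unfolding add_divide_distrib[symmetric] by (rule arg_cong[where f = "\<lambda>y. y / ?r"]) simp
      finally have sum: "(2 * x - 1) / ?r + ?r = (x + x\<^sup>2) / ?r" .
      have "?K\<^sup>2 * (- x / 2 + (y + ?r)) = (- 1 + y) * ?K\<^sup>2 + (2 - x + 2 * ?r) * (?K * (?K / 2))" for y
        by (simp add: power2_eq_square algebra_simps)
      from this[of "(2 * x - 1) / ?r"] show ?thesis unfolding sum .
    qed
    also have "(2 - x + 2 * ?r) * (?K * (?K / 2)) \<le> (2 - x + 2 * ?r) * (?K * ell_int 1 (x, pi/2))"
      using ell_K_deriv_ge[of x] x K r by (intro mult_left_mono) auto
    finally show ?thesis by simp
  qed
  have "?f 0 < ?f m"
  proof (rule DERIV_pos_imp_increasing_open[OF assms(1)])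
    show "continuous_on {0..m} ?f"
      using assms by (intro continuous_at_imp_continuous_on ballI DERIV_isCont[OF d]) auto
    show "\<exists>D. (?f has_real_derivative D) (at x) \<and> 0 < D" if "0 < x" "x < m" for x
      using d[of x] pos[of x] that assms by (intro exI[of _ "?D x"]) simp
  qed
  then show ?thesis by (simp add: ell_K_0 quad_root_def power_divide)
qed

section \<open>The amplitude function\<close>

lemma jacobi_am_elliptic_F:
  assumes k: "k \<in> {0<..<1}"
  shows "jacobi_am (elliptic_F \<theta> k) k = \<theta>"
proof -
  have "inj (\<lambda>\<theta>. elliptic_F \<theta> k)"
    using ell_int_0_strict_mono[OF modulus_square_less_1[OF k]]
    by (intro strict_mono_imp_inj_on strict_monoI)
      (simp add: elliptic_F_eq[OF modulus_square_less_1[OF k]])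
  then show ?thesis
    unfolding jacobi_am_def by (auto dest: injD)
qed

lemma elliptic_F_jacobi_am:
  assumes k: "k \<in> {0<..<1}"
  shows "elliptic_F (jacobi_am u k) k = u"
proof -
  obtain \<theta> where "elliptic_F \<theta> k = u"
    using ell_int_surj[of "k\<^sup>2" u] modulus_square_less_1[OF k] by (auto simp: elliptic_F_eq)
  then show ?thesis using jacobi_am_elliptic_F[OF k] by metis
qed

lemma jacobi_am_deriv:
  assumes k: "k \<in> {0<..<1}"
  shows "((\<lambda>u. jacobi_am u k) has_real_derivative sqrt (1 - k\<^sup>2 * (sin (jacobi_am u k))\<^sup>2)) (at u)"
proof -
  note k2 = modulus_square_less_1[OF k]
  let ?F = "\<lambda>\<theta>. elliptic_F \<theta> k"
  have d: "(?F has_real_derivative ell_kernel 0 (k\<^sup>2) \<theta>) (at \<theta>)" for \<theta>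
    using ell_int_deriv_\<theta>[OF k2, of 0 \<theta>] by (simp add: elliptic_F_eq[OF k2])
  define c where "c = ell_kernel 0 (k\<^sup>2) (jacobi_am u k)"
  have c: "c > 0" using ell_kernel_0_pos[OF k2] by (simp add: c_def)
  have "((\<lambda>u. jacobi_am u k) has_derivative (*) (inverse c)) (at (?F (jacobi_am u k)))"
  proof (rule has_derivative_inverse_strong[where S = UNIV and f = ?F and f' = "(*) c"])
    show "continuous_on UNIV ?F"
      by (intro continuous_at_imp_continuous_on ballI DERIV_isCont[OF d])
    show "(?F has_derivative (*) c) (at (jacobi_am u k))"
      using d unfolding has_field_derivative_def c_def .
    show "(*) c \<circ> (*) (inverse c) = id" using c by auto
  qed (simp_all add: jacobi_am_elliptic_F[OF k])
  then show ?thesis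
    by (simp add: elliptic_F_jacobi_am[OF k] c_def ell_kernel_0[OF k2] has_field_derivative_def)
qed

lemma jacobi_am_add_4K:
  assumes k: "k \<in> {0<..<1}"
  shows "jacobi_am (u + 4 * elliptic_K k) k = jacobi_am u k + 2 * pi"
proof -
  note k2 = modulus_square_less_1[OF k]
  have "elliptic_F (jacobi_am u k + 2 * pi) k = elliptic_F ((jacobi_am u k + pi) + pi) k"
    by (simp add: algebra_simps)
  also have "\<dots> = u + 4 * elliptic_K k"
    using elliptic_F_jacobi_am[OF k, of u]
    unfolding elliptic_F_eq[OF k2] elliptic_K_eq[OF k2] ell_int_add_pi[OF k2] by simp
  finally show ?thesis using jacobi_am_elliptic_F[OF k] by metis
qed

section \<open>The profile equation\<close>

lemma wave_q_eq: "wave_q k = - 1 + k\<^sup>2 - quad_root (k\<^sup>2)"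
  by (simp add: wave_q_def quad_root_def power_mult[symmetric])

lemma wave_\<omega>_eq: "k\<^sup>2 < 1 \<Longrightarrow> wave_\<omega> L k = 16 * freq (k\<^sup>2) / L\<^sup>2"
  by (simp add: wave_\<omega>_def freq_def elliptic_K_eq quad_root_def power_mult[symmetric] mult_ac)

lemma wave_q_less: "k \<in> {0<..<1} \<Longrightarrow> wave_q k < - 1"
proof -
  assume k: "k \<in> {0<..<1}"
  have "k\<^sup>2 < quad_root (k\<^sup>2)"
    unfolding quad_root_def by (rule real_less_rsqrt) (use modulus_square_less_1[OF k] in simp)
  then show ?thesis by (simp add: wave_q_eq)
qed

lemma wave_q_greater: "k \<in> {0<..<1} \<Longrightarrow> wave_q k > - 2"
proof -
  assume k: "k \<in> {0<..<1}"
  then have "k\<^sup>2 > 0" by simp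
  with quad_root_less_1[OF this modulus_square_less_1[OF k]] show ?thesis
    unfolding wave_q_eq by linarith
qed

lemma profile_pos: "q < 0 \<Longrightarrow> 1 - q * (sin t)\<^sup>2 > (0::real)"
  using mult_nonpos_nonneg[of q "(sin t)\<^sup>2"] by simp

lemma profile_deriv:
  fixes q :: real
  assumes "q < 0"
  shows "((\<lambda>t. cos t / sqrt (1 - q * (sin t)\<^sup>2)) has_real_derivative
    - (1 - q) * sin t * (1 - q * (sin t)\<^sup>2) powr - (3/2)) (at t)"
proof -
  define D where "D t = 1 - q * (sin t)\<^sup>2" for t
  have D: "D t > 0" for t using profile_pos[OF assms] by (simp add: D_def)
  have dD: "(D has_real_derivative - 2 * q * sin t * cos t) (at t)"
    unfolding D_def[abs_def] by (auto intro!: derivative_eq_intros)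
  define Y where "Y = D t powr - (3/2)"
  have Y: "D t powr - (1/2) = D t * Y"
    using D[of t] powr_mult_base[of "D t" "- (3/2)"] by (simp add: Y_def)
  have dP: "((\<lambda>t. D t powr - (1/2)) has_real_derivative q * sin t * cos t * Y) (at t)"
    using DERIV_fun_powr[OF dD D, of "- (1/2)"] by (simp add: Y_def mult_ac)
  have "((\<lambda>t. cos t * D t powr - (1/2)) has_real_derivative
      - sin t * (D t * Y) + q * sin t * cos t * Y * cos t) (at t)"
    unfolding Y[symmetric] by (rule DERIV_mult[OF DERIV_cos dP])
  moreover have "- sin t * (D t * Y) + q * sin t * cos t * Y * cos t = - (1 - q) * sin t * Y"
  proof -
    have "- sin t * (D t * Y) + q * sin t * cos t * Y * cos t = (q * (cos t)\<^sup>2 - D t) * sin t * Y"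
      by (simp add: power2_eq_square algebra_simps)
    also have "q * (cos t)\<^sup>2 - D t = - (1 - q)"
      by (simp add: D_def cos_squared_eq algebra_simps)
    finally show ?thesis .
  qed
  moreover have "(\<lambda>t. cos t * D t powr - (1/2)) = (\<lambda>t. cos t / sqrt (D t))"
    unfolding powr_minus powr_half_sqrt[OF less_imp_le[OF D]] inverse_eq_divide by simp
  ultimately have "((\<lambda>t. cos t / sqrt (D t)) has_real_derivative - (1 - q) * sin t * Y) (at t)"
    by (simp only:)
  then show ?thesis unfolding Y_def D_def .
qed

text \<open>
The function differentiated here is the derivative of the profile along the flow \<open>\<theta>' = \<surd>(1 - m sin\<^sup>2 \<theta>)\<close>.
Multiplying the result by \<open>\<surd>(1 - m sin\<^sup>2 \<theta>)\<close> gives the second derivative along the flow.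
\<close>

lemma profile_second_deriv:
  fixes q m :: real
  assumes "q < 0" "m < 1"
  shows "((\<lambda>t. - (1 - q) * sin t * (1 - q * (sin t)\<^sup>2) powr - (3/2) * sqrt (1 - m * (sin t)\<^sup>2))
    has_real_derivative
     - (1 - q) * cos t * (1 - q * (sin t)\<^sup>2) powr - (5/2)
      * ((1 - 2 * m * (sin t)\<^sup>2) * (1 - q * (sin t)\<^sup>2) + 3 * q * (sin t)\<^sup>2 * (1 - m * (sin t)\<^sup>2))
      / sqrt (1 - m * (sin t)\<^sup>2)) (at t)"
proof -
  define D where "D t = 1 - q * (sin t)\<^sup>2" for t
  define X where "X t = 1 - m * (sin t)\<^sup>2" for t
  have D: "D t > 0" for t using profile_pos[OF assms(1)] by (simp add: D_def)
  have X: "X t > 0" for t using m_sin_sq_less_1[OF assms(2)] by (simp add: X_def)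
  have dD: "(D has_real_derivative - 2 * q * sin t * cos t) (at t)"
    unfolding D_def[abs_def] by (auto intro!: derivative_eq_intros)
  have dX: "(X has_real_derivative - 2 * m * sin t * cos t) (at t)"
    unfolding X_def[abs_def] by (auto intro!: derivative_eq_intros)
  define Y where "Y = D t powr - (5/2)"
  define E where "E = sqrt (X t)"
  have E: "E > 0" "E * E = X t" using X[of t] by (simp_all add: E_def)
  have Y3: "D t powr - (3/2) = D t * Y"
    using D[of t] powr_mult_base[of "D t" "- (5/2)"] by (simp add: Y_def)
  have dP: "((\<lambda>t. D t powr - (3/2)) has_real_derivative 3 * q * sin t * cos t * Y) (at t)"
    using DERIV_fun_powr[OF dD D, of "- (3/2)"] by (simp add: Y_def mult_ac)
  have dE: "((\<lambda>t. sqrt (X t)) has_real_derivative - m * sin t * cos t / E) (at t)"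
    using DERIV_chain2[OF DERIV_real_sqrt[OF X] dX] by (simp add: E_def divide_simps mult.assoc)
  have "((\<lambda>t. - (1 - q) * (sin t * D t powr - (3/2) * sqrt (X t))) has_real_derivative
      - (1 - q) * ((sin t * (3 * q * sin t * cos t * Y) + cos t * (D t * Y)) * E
        + (sin t * (D t * Y)) * (- m * sin t * cos t / E))) (at t)"
    unfolding Y3[symmetric] E_def[symmetric]
    by (rule derivative_eq_intros dP dE refl)+ (simp add: E_def algebra_simps)
  moreover have "(sin t * (3 * q * sin t * cos t * Y) + cos t * (D t * Y)) * E
        + (sin t * (D t * Y)) * (- m * sin t * cos t / E)
      = cos t * Y * ((1 - 2 * m * (sin t)\<^sup>2) * D t + 3 * q * (sin t)\<^sup>2 * X t) / E"
  proof -
    have "((sin t * (3 * q * sin t * cos t * Y) + cos t * (D t * Y)) * E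
        + (sin t * (D t * Y)) * (- m * sin t * cos t / E)) * E
      = (sin t * (3 * q * sin t * cos t * Y) + cos t * (D t * Y)) * (E * E)
        - (sin t * (D t * Y)) * (m * sin t * cos t)"
      using E(1) by (simp add: algebra_simps)
    also have "\<dots> = cos t * Y * ((1 - 2 * m * (sin t)\<^sup>2) * D t + 3 * q * (sin t)\<^sup>2 * X t)"
      unfolding E(2) by (simp add: X_def power2_eq_square algebra_simps)
    finally show ?thesis using E(1) by (simp add: eq_divide_eq)
  qed
  ultimately show ?thesis
    by (simp add: D_def[symmetric] X_def[symmetric] Y_def[symmetric] E_def[symmetric] mult_ac)
qed

lemma profile_identity:
  fixes m r q z :: real
  assumes "r\<^sup>2 = m\<^sup>2 - m + 1" and "q = - 1 + m - r"
  shows "(1 - q) * ((1 - 2 * m * z) * (1 - q * z) + 3 * q * z * (1 - m * z))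
    = (2 - m + 2 * r) * (1 - z)\<^sup>2 - r * (1 - q * z)\<^sup>2"
  using assms by algebra

text \<open>
The left-hand side is the second derivative of \<open>f\<close> along the flow of the amplitude, so this is the equation
\<open>f'' = r f - (2 - m + 2 r) f\<^sup>5\<close>. After a factor \<open>cos t (1 - q sin\<^sup>2 t) powr (-5/2)\<close> is removed, it is
\<open>profile_identity\<close> for \<open>z = sin\<^sup>2 t\<close>.
\<close>

lemma profile_equation:
  fixes m r q :: real
  assumes r: "r\<^sup>2 = m\<^sup>2 - m + 1" "q = - 1 + m - r" and q: "q < 0"
  defines "f \<equiv> \<lambda>t. cos t / sqrt (1 - q * (sin t)\<^sup>2)"
  shows "- (1 - q) * cos t * (1 - q * (sin t)\<^sup>2) powr - (5/2)
      * ((1 - 2 * m * (sin t)\<^sup>2) * (1 - q * (sin t)\<^sup>2) + 3 * q * (sin t)\<^sup>2 * (1 - m * (sin t)\<^sup>2))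
    = r * f t - (2 - m + 2 * r) * f t ^ 5"
proof -
  define z where "z = (sin t)\<^sup>2"
  define D where "D = 1 - q * z"
  define Y where "Y = D powr - (5/2)"
  have D: "D > 0" using profile_pos[OF q] by (simp add: D_def z_def)
  have f: "f t = cos t * D powr - (1/2)"
    unfolding f_def z_def[symmetric] D_def[symmetric] powr_minus powr_half_sqrt[OF less_imp_le[OF D]]
    by (simp add: divide_inverse)
  have "D powr - (1/2) = D\<^sup>2 * Y"
    unfolding Y_def powr_numeral[OF less_imp_le[OF D], symmetric] powr_add[symmetric] by simp
  then have f1: "f t = cos t * (D\<^sup>2 * Y)" unfolding f by (simp only:)
  have c5: "(cos t) ^ 5 = cos t * (1 - z)\<^sup>2"
  proof -
    have "(cos t) ^ 5 = cos t * ((cos t)\<^sup>2)\<^sup>2" by (simp add: eval_nat_numeral)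
    then show ?thesis by (simp add: z_def cos_squared_eq)
  qed
  have "(D powr - (1/2)) ^ 5 = Y"
    using D by (simp add: Y_def powr_power)
  then have f5: "f t ^ 5 = cos t * (1 - z)\<^sup>2 * Y"
    unfolding f power_mult_distrib c5 by (simp only:)
  have "- (1 - q) * cos t * Y * ((1 - 2 * m * z) * (1 - q * z) + 3 * q * z * (1 - m * z))
      = - ((1 - q) * ((1 - 2 * m * z) * (1 - q * z) + 3 * q * z * (1 - m * z))) * (cos t * Y)"
    by (simp only: mult_ac mult_minus_left)
  also have "\<dots> = r * f t - (2 - m + 2 * r) * f t ^ 5"
    unfolding profile_identity[OF r] f5 unfolding f1[unfolded D_def] by (simp add: algebra_simps)
  finally show ?thesis unfolding z_def Y_def D_def .
qed

text \<open>
Scaling \<open>f'' = r f - (2 - m + 2 r) f\<^sup>5\<close> to \<open>\<phi>(x) = A f(\<theta>(x))\<close> gives the frequency \<open>b\<^sup>2 r\<close> and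
the condition \<open>c A\<^sup>4 = b\<^sup>2 (2 - m + 2 r)\<close>; these are the formulas for \<open>\<omega>\<close> and \<open>a\<close>.
\<close>

lemma cnoidal_profile_solves:
  assumes c: "\<kappa> + \<gamma> * B ^ 3 > 0" and L: "L > 0" and k: "k \<in> {0<..<1}"
  shows "solves_wave_eq \<kappa> \<gamma> B (wave_\<omega> L k) (cnoidal_wave \<kappa> \<gamma> B L k)"
proof -
  define m where "m = k\<^sup>2"
  define r where "r = quad_root m"
  define q where "q = wave_q k"
  define c where "c = \<kappa> + \<gamma> * B ^ 3"
  define b where "b = 4 * elliptic_K k / L"
  define A where "A = 1 / root 4 c * wave_a L k"
  define P where "P = 2 - m + 2 * r"
  have m: "m < 1" using modulus_square_less_1[OF k] by (simp add: m_def)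
  have q: "q < 0" using wave_q_less[OF k] by (simp add: q_def)
  have r: "r\<^sup>2 = m\<^sup>2 - m + 1" "q = - 1 + m - r" "r > 0"
    by (simp_all add: r_def quad_root_sq quad_root_pos q_def wave_q_eq m_def)
  have P: "P > 0" using r m by (simp add: P_def)
  have b2: "wave_\<omega> L k = b\<^sup>2 * r"
    by (simp add: wave_\<omega>_def b_def r_def m_def quad_root_def power_mult[symmetric] power_divide power_mult_distrib)
  have "root 4 c ^ 4 = c" using c by (simp add: c_def)
  moreover have "wave_a L k ^ 4 = b\<^sup>2 * P"
  proof -
    have "(2 - k\<^sup>2 + 2 * sqrt (k ^ 4 - k\<^sup>2 + 1)) * L\<^sup>2 * (elliptic_K k)\<^sup>2 = P * L\<^sup>2 * (elliptic_K k)\<^sup>2"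
      by (simp add: P_def m_def r_def quad_root_def power_mult[symmetric])
    then have "wave_a L k = (2 / L) * root 4 (P * L\<^sup>2 * (elliptic_K k)\<^sup>2)"
      by (simp only: wave_a_def)
    moreover have "root 4 (P * L\<^sup>2 * (elliptic_K k)\<^sup>2) ^ 4 = P * L\<^sup>2 * (elliptic_K k)\<^sup>2"
      using P by (intro real_root_pow_pos2) auto
    ultimately have "wave_a L k ^ 4 = (2 / L) ^ 4 * (P * L\<^sup>2 * (elliptic_K k)\<^sup>2)"
      by (simp only: power_mult_distrib)
    then show ?thesis
      using L by (simp add: b_def power2_eq_square power4_eq_xxxx field_simps)
  qed
  ultimately have A4: "c * A ^ 4 = b\<^sup>2 * P"
    using c by (simp add: A_def power_mult_distrib power_divide c_def)
  let ?\<theta> = "\<lambda>x. jacobi_am (b * x) k"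
  let ?E = "\<lambda>t. sqrt (1 - m * (sin t)\<^sup>2)"
  let ?D = "\<lambda>t. 1 - q * (sin t)\<^sup>2"
  let ?f = "\<lambda>t. cos t / sqrt (?D t)"
  let ?g = "\<lambda>t. - (1 - q) * sin t * ?D t powr - (3/2) * ?E t"
  let ?N = "\<lambda>t. (1 - 2 * m * (sin t)\<^sup>2) * ?D t + 3 * q * (sin t)\<^sup>2 * (1 - m * (sin t)\<^sup>2)"
  let ?h = "\<lambda>t. - (1 - q) * cos t * ?D t powr - (5/2) * ?N t"
  have \<phi>: "cnoidal_wave \<kappa> \<gamma> B L k = (\<lambda>x. A * ?f (?\<theta> x))"
    by (rule ext) (simp add: cnoidal_wave_def cnoidal_profile_def A_def b_def c_def q_def jacobi_cn_def jacobi_sn_def)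
  have d\<theta>: "(?\<theta> has_real_derivative b * ?E (?\<theta> x)) (at x)" for x
    using DERIV_chain2[OF jacobi_am_deriv[OF k] DERIV_cmult_Id, of b x UNIV]
    unfolding m_def by (simp only: mult.commute[of b "sqrt _"])
  have d1: "((\<lambda>x. A * ?f (?\<theta> x)) has_real_derivative A * b * ?g (?\<theta> x)) (at x)" for x
    by (rule DERIV_cong[OF DERIV_cmult[OF DERIV_chain2[OF profile_deriv[OF q] d\<theta>]]])
      (simp only: mult_ac)
  have d2: "((\<lambda>x. A * b * ?g (?\<theta> x)) has_real_derivative A * b\<^sup>2 * ?h (?\<theta> x)) (at x)" for x
  proof -
    have "?E (?\<theta> x) > 0" using m_sin_sq_less_1[OF m] by simp
    then have "A * b * (?h (?\<theta> x) / ?E (?\<theta> x) * (b * ?E (?\<theta> x))) = A * b\<^sup>2 * ?h (?\<theta> x)"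
      by (simp add: power2_eq_square)
    then show ?thesis
      by (rule DERIV_cong[OF DERIV_cmult[OF DERIV_chain2[OF profile_second_deriv[OF q m] d\<theta>]]])
  qed
  have eq: "- (A * b\<^sup>2 * ?h t) + wave_\<omega> L k * (A * ?f t) - c * (A * ?f t) ^ 5 = 0" for t
  proof -
    have "- (A * b\<^sup>2 * (r * F - P * F ^ 5)) + b\<^sup>2 * r * (A * F) - c * (A * F) ^ 5 = 0" for F
    proof -
      have "c * (A * F) ^ 5 = A * (c * A ^ 4) * F ^ 5"
        by (simp add: power_mult_distrib eval_nat_numeral)
      then have "c * (A * F) ^ 5 = A * (b\<^sup>2 * P) * F ^ 5" unfolding A4 .
      then show ?thesis by (simp only:) (simp add: algebra_simps)
    qed
    then show ?thesis
      unfolding b2 profile_equation[OF r(1,2) q] P_def .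
  qed
  show ?thesis
    unfolding solves_wave_eq_def \<phi> c_def[symmetric]
  proof (intro exI conjI allI)
    show "((\<lambda>x. A * ?f (?\<theta> x)) has_real_derivative A * b * ?g (?\<theta> x)) (at x)" for x by (rule d1)
    show "((\<lambda>x. A * b * ?g (?\<theta> x)) has_real_derivative A * b\<^sup>2 * ?h (?\<theta> x)) (at x)" for x by (rule d2)
    show "- (A * b\<^sup>2 * ?h (?\<theta> x)) + wave_\<omega> L k * (A * ?f (?\<theta> x)) - c * (A * ?f (?\<theta> x)) ^ 5 = 0" for x
      by (rule eq)
  qed
qed

lemma periodic_cnoidal_wave:
  assumes L: "L > 0" and k: "k \<in> {0<..<1}"
  shows "periodic L (cnoidal_wave \<kappa> \<gamma> B L k)"
proof -
  have "4 * elliptic_K k / L * (x + L) = 4 * elliptic_K k / L * x + 4 * elliptic_K k" for x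
    using L by (simp add: field_simps)
  then show ?thesis
    by (simp add: periodic_def cnoidal_wave_def cnoidal_profile_def jacobi_cn_def jacobi_sn_def
        jacobi_am_add_4K[OF k])
qed

section \<open>Smooth dependence on the modulus\<close>

lemma admissible_B_coefficient_pos:
  assumes "\<kappa> > 0" "\<gamma> \<ge> 0" "admissible_B \<kappa> \<gamma> B"
  shows "\<kappa> + \<gamma> * B ^ 3 > 0"
proof -
  consider "\<gamma> > 2 * \<kappa>" "B = (\<gamma> + sqrt (\<gamma>\<^sup>2 - 4 * \<kappa>\<^sup>2)) / (2 * \<kappa>) \<or> B = (\<gamma> - sqrt (\<gamma>\<^sup>2 - 4 * \<kappa>\<^sup>2)) / (2 * \<kappa>)"
    | "B = 1" | "B = - 1" "\<gamma> < \<kappa>"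
    using assms(3) unfolding admissible_B_def by blast
  then show ?thesis
  proof cases
    case 1
    have "(2 * \<kappa>)\<^sup>2 \<le> \<gamma>\<^sup>2" using 1(1) assms(1) by (intro power_mono) auto
    then have "0 \<le> \<gamma>\<^sup>2 - 4 * \<kappa>\<^sup>2" by (simp add: power_mult_distrib)
    moreover have "sqrt (\<gamma>\<^sup>2 - 4 * \<kappa>\<^sup>2) < \<gamma>"
      using assms 1(1) by (intro real_less_lsqrt) auto
    ultimately have "\<gamma> + sqrt (\<gamma>\<^sup>2 - 4 * \<kappa>\<^sup>2) > 0" "\<gamma> - sqrt (\<gamma>\<^sup>2 - 4 * \<kappa>\<^sup>2) > 0"
      using 1(1) assms(1) by (auto simp: add_pos_nonneg)
    then have "B > 0" using 1(2) assms(1) by auto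
    then show ?thesis using assms by (simp add: add_pos_nonneg)
  qed (use assms in auto)
qed

lemma C_infinity_on_elliptic_K: "C_infinity_on elliptic_K {0<..<1}"
proof -
  have "C_infinity_on (\<lambda>k::real. (k\<^sup>2, pi / 2)) {0<..<1}"
    by (intro C_infinity_on_Pair C_infinity_on_power C_infinity_on_ident C_infinity_on_const
        open_greaterThanLessThan)
  then have "C_infinity_on (\<lambda>k. ell_int 0 (k\<^sup>2, pi / 2)) {0<..<1}"
    by (intro C_infinity_on_compose[OF open_greaterThanLessThan C_infinity_on_ell_int])
      (auto simp: open_Times abs_square_less_1)
  then show ?thesis
    by (rule C_infinity_on_cong[OF open_greaterThanLessThan, THEN iffD1, rotated])
      (use modulus_square_less_1 in \<open>simp add: elliptic_K_eq ell_K_def\<close>)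
qed

lemma modulus_quad_pos: "k ^ 4 - k\<^sup>2 + 1 > (0::real)"
  using quad_pos[of "k\<^sup>2"] by (simp add: power_mult[symmetric])

lemma elliptic_K_pos: "k \<in> {0<..<1} \<Longrightarrow> elliptic_K k > 0"
  using modulus_square_less_1 by (simp add: elliptic_K_eq ell_K_pos)

lemma wave_a_radicand_pos:
  assumes "k \<in> {0<..<1}" "l > 0"
  shows "(2 - k\<^sup>2 + 2 * sqrt (k ^ 4 - k\<^sup>2 + 1)) * l\<^sup>2 * (elliptic_K k)\<^sup>2 > 0"
proof -
  have "2 - k\<^sup>2 + 2 * sqrt (k ^ 4 - k\<^sup>2 + 1) > 0"
    using modulus_square_less_1[OF assms(1)] modulus_quad_pos[of k] by (intro add_pos_pos) auto
  then show ?thesis using elliptic_K_pos[OF assms(1)] assms(2) by simp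
qed

context
  fixes S :: "'a::real_normed_vector set" and u :: "'a \<Rightarrow> real"
  assumes S: "open S" and u: "C_infinity_on u S" and uS: "\<And>x. x \<in> S \<Longrightarrow> u x \<in> {0<..<1}"
begin

lemma C_infinity_on_elliptic_K_compose: "C_infinity_on (\<lambda>x. elliptic_K (u x)) S"
  by (rule C_infinity_on_compose[OF S C_infinity_on_elliptic_K open_greaterThanLessThan u uS])

lemma C_infinity_on_modulus_root: "C_infinity_on (\<lambda>x. sqrt (u x ^ 4 - (u x)\<^sup>2 + 1)) S"
  by (intro C_infinity_on_sqrt C_infinity_on_add C_infinity_on_diff C_infinity_on_power
      C_infinity_on_const S u modulus_quad_pos)

lemma C_infinity_on_wave_q: "C_infinity_on (\<lambda>x. wave_q (u x)) S"
  unfolding wave_q_def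
  by (intro C_infinity_on_modulus_root C_infinity_on_add C_infinity_on_diff C_infinity_on_power
      C_infinity_on_const S u)

lemma C_infinity_on_wave_\<omega>:
  assumes v: "C_infinity_on v S" and vS: "\<And>x. x \<in> S \<Longrightarrow> v x > 0"
  shows "C_infinity_on (\<lambda>x. wave_\<omega> (v x) (u x)) S"
  unfolding wave_\<omega>_def
  by (intro C_infinity_on_divide C_infinity_on_modulus_root C_infinity_on_mult C_infinity_on_power
      C_infinity_on_const C_infinity_on_elliptic_K_compose S v zero_less_power vS)

lemma C_infinity_on_wave_a:
  assumes v: "C_infinity_on v S" and vS: "\<And>x. x \<in> S \<Longrightarrow> v x > 0"
  shows "C_infinity_on (\<lambda>x. wave_a (v x) (u x)) S"
  unfolding wave_a_def
  by (intro C_infinity_on_mult C_infinity_on_divide C_infinity_on_root C_infinity_on_modulus_root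
      C_infinity_on_add C_infinity_on_diff C_infinity_on_power
      C_infinity_on_const C_infinity_on_elliptic_K_compose S u v vS wave_a_radicand_pos uS) simp_all

end

section \<open>The frequency as a parameter\<close>

lemma wave_\<omega>_deriv_pos:
  assumes L: "L > 0" and k: "k \<in> {0<..<1}"
  shows "\<exists>D>0. (wave_\<omega> L has_real_derivative D) (at k)"
proof -
  let ?F = "ell_K (k\<^sup>2) * ell_int 1 (k\<^sup>2, pi/2) * quad_root (k\<^sup>2)
    + (ell_K (k\<^sup>2))\<^sup>2 * ((2 * k\<^sup>2 - 1) / (2 * quad_root (k\<^sup>2)))"
  note k2 = modulus_square_less_1[OF k]
  have pos: "?F > 0" using freq_deriv_pos[of "k\<^sup>2"] k k2 by simp
  have "((\<lambda>k. k\<^sup>2) has_real_derivative 2 * k) (at k)"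
    by (auto intro!: derivative_eq_intros)
  from DERIV_cmult[OF DERIV_chain2[OF freq_deriv[OF k2] this], of "16 / L\<^sup>2"]
  have "((\<lambda>k. 16 / L\<^sup>2 * freq (k\<^sup>2)) has_real_derivative 16 / L\<^sup>2 * (?F * (2 * k))) (at k)" .
  then have "(wave_\<omega> L has_real_derivative 16 / L\<^sup>2 * (?F * (2 * k))) (at k)"
    by (rule has_field_derivative_transform_within_open[OF _ open_greaterThanLessThan k])
      (simp add: wave_\<omega>_eq modulus_square_less_1)
  moreover have "16 / L\<^sup>2 * (?F * (2 * k)) > 0"
    using L k by (intro mult_pos_pos divide_pos_pos pos) auto
  ultimately show ?thesis by blast
qed

lemma wave_\<omega>_strict_mono:
  assumes L: "L > 0" and "k \<in> {0<..<1}" "k' \<in> {0<..<1}" "k < k'"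
  shows "wave_\<omega> L k < wave_\<omega> L k'"
proof -
  have "k\<^sup>2 < k'\<^sup>2" using assms by (intro power_strict_mono) auto
  then have "freq (k\<^sup>2) < freq (k'\<^sup>2)"
    using assms by (intro freq_strict_mono modulus_square_less_1) auto
  then show ?thesis
    using assms modulus_square_less_1 by (simp add: wave_\<omega>_eq divide_strict_right_mono)
qed

lemma wave_\<omega>_gt:
  assumes L: "L > 0" and k: "k \<in> {0<..<1}"
  shows "wave_\<omega> L k > 4 * pi\<^sup>2 / L\<^sup>2"
proof -
  have "pi\<^sup>2 / 4 < freq (k\<^sup>2)"
    using freq_strict_mono[of 0 "k\<^sup>2"] modulus_square_less_1[OF k] k freq_0 by simp
  then have "4 * pi\<^sup>2 < 16 * freq (k\<^sup>2)" by simp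
  then show ?thesis
    using L modulus_square_less_1[OF k] by (simp add: wave_\<omega>_eq divide_strict_right_mono)
qed

lemma wave_\<omega>_surj:
  assumes L: "L > 0" and \<omega>: "\<omega> > 4 * pi\<^sup>2 / L\<^sup>2"
  shows "\<exists>k. k \<in> {0<..<1} \<and> wave_\<omega> L k = \<omega>"
proof -
  define y where "y = \<omega> * L\<^sup>2 / 16"
  have y: "y > pi\<^sup>2 / 4" using \<omega> L by (simp add: y_def field_simps)
  obtain m1 where m1: "0 < m1" "m1 < 1" "freq m1 > y" by (rule freq_unbounded)
  have "\<exists>m\<ge>0. m \<le> m1 \<and> freq m = y"
  proof (rule IVT)
    show "freq 0 \<le> y" "y \<le> freq m1" "0 \<le> m1" using y m1 by (auto simp: freq_0)
    show "\<forall>m. 0 \<le> m \<and> m \<le> m1 \<longrightarrow> isCont freq m"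
      using m1 by (auto intro!: DERIV_isCont[OF freq_deriv])
  qed
  then obtain m where m: "0 \<le> m" "m \<le> m1" "freq m = y" by blast
  have "m \<noteq> 0" using m y freq_0 by auto
  then have "sqrt m \<in> {0<..<1}" using m m1 by auto
  moreover have "wave_\<omega> L (sqrt m) = 16 * freq m / L\<^sup>2"
    using m m1 by (simp add: wave_\<omega>_eq)
  then have "wave_\<omega> L (sqrt m) = \<omega>"
    using L unfolding m(3) y_def by simp
  ultimately show ?thesis by blast
qed

lemma wave_\<omega>_ex1:
  assumes L: "L > 0" and \<omega>: "\<omega> > 4 * pi\<^sup>2 / L\<^sup>2"
  shows "\<exists>!k. k \<in> {0<..<1} \<and> wave_\<omega> L k = \<omega>"
proof (rule ex_ex1I[OF wave_\<omega>_surj[OF assms]])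
  fix k k' assume "k \<in> {0<..<1} \<and> wave_\<omega> L k = \<omega>" "k' \<in> {0<..<1} \<and> wave_\<omega> L k' = \<omega>"
  then show "k = k'"
    using wave_\<omega>_strict_mono[OF L, of k k'] wave_\<omega>_strict_mono[OF L, of k' k]
    by (cases k k' rule: linorder_cases) auto
qed

lemma modulus_of:
  assumes L: "L > 0" and \<omega>: "\<omega> > 4 * pi\<^sup>2 / L\<^sup>2"
  shows "modulus_of L \<omega> \<in> {0<..<1}" and "wave_\<omega> L (modulus_of L \<omega>) = \<omega>"
  using theI'[OF wave_\<omega>_ex1[OF assms]] unfolding modulus_of_def by blast+

lemma modulus_of_wave_\<omega>:
  assumes L: "L > 0" and k: "k \<in> {0<..<1}"
  shows "modulus_of L (wave_\<omega> L k) = k"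
  using wave_\<omega>_ex1[OF L wave_\<omega>_gt[OF L k]] modulus_of[OF L wave_\<omega>_gt[OF L k]] k by blast

lemma wave_a_gt:
  assumes L: "L > 0" and k: "k \<in> {0<..<1}"
  shows "wave_a L k > 2 * sqrt (pi / L)"
proof -
  note k2 = modulus_square_less_1[OF k]
  let ?Q = "(2 - k\<^sup>2 + 2 * sqrt (k ^ 4 - k\<^sup>2 + 1)) * L\<^sup>2 * (elliptic_K k)\<^sup>2"
  have "pi\<^sup>2 < (2 - k\<^sup>2 + 2 * quad_root (k\<^sup>2)) * (ell_K (k\<^sup>2))\<^sup>2"
    using amplitude_gt[of "k\<^sup>2"] k k2 by simp
  then have "L\<^sup>2 * pi\<^sup>2 < L\<^sup>2 * ((2 - k\<^sup>2 + 2 * quad_root (k\<^sup>2)) * (ell_K (k\<^sup>2))\<^sup>2)"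
    using L by simp
  then have "(L * pi)\<^sup>2 < ?Q"
    by (simp add: elliptic_K_eq[OF k2] quad_root_def power_mult[symmetric] power_mult_distrib mult_ac)
  then have "root 4 ((L * pi)\<^sup>2) < root 4 ?Q" by simp
  moreover have "root 4 ((L * pi)\<^sup>2) = sqrt (L * pi)"
  proof -
    have "(L * pi)\<^sup>2 = sqrt (L * pi) ^ 4"
      using L by (simp add: power4_eq_xxxx power2_eq_square)
    then show ?thesis using L by (simp add: real_root_power_cancel)
  qed
  moreover have "sqrt (L * pi) / L = sqrt (pi / L)"
    using L by (simp add: real_sqrt_mult real_sqrt_divide field_simps flip: power2_eq_square)
  ultimately have "sqrt (pi / L) < root 4 ?Q / L"
    using L by (metis divide_strict_right_mono)
  then show ?thesis by (simp add: wave_a_def)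
qed

section \<open>The curve of waves\<close>

text \<open>
This map inverts \<open>(k, \<theta>) \<mapsto> (\<omega>(k), L F(\<theta>, k) / (4 K(k)))\<close>, whose Jacobian matrix is triangular with
positive diagonal: \<open>\<omega>\<close> increases with \<open>k\<close>, and \<open>F\<close> increases with \<open>\<theta>\<close>.
\<close>

lemma C_infinity_on_modulus_amplitude:
  assumes L: "L > 0"
  shows "C_infinity_on (\<lambda>(\<omega>, x). (modulus_of L \<omega>, jacobi_am (4 * elliptic_K (modulus_of L \<omega>) / L * x) (modulus_of L \<omega>)))
    ({4 * pi\<^sup>2 / L\<^sup>2<..} \<times> UNIV)"
proof -
  let ?S = "{0<..<1::real} \<times> (UNIV :: real set)"
  define f where "f p = wave_\<omega> L (fst p)" for p :: "real \<times> real"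
  define g where "g p = L / (4 * elliptic_K (fst p)) * ell_int 0 ((fst p)\<^sup>2, snd p)" for p
  have S: "open ?S" by (simp add: open_Times)
  have T: "open ({4 * pi\<^sup>2 / L\<^sup>2<..} \<times> (UNIV :: real set))" by (simp add: open_Times)
  have k: "C_infinity_on fst ?S"
    by (rule C_infinity_on_fst[OF S C_infinity_on_ident[OF S]])
  have x: "C_infinity_on snd ?S"
    by (rule C_infinity_on_snd[OF S C_infinity_on_ident[OF S]])
  have f: "C_infinity_on f ?S"
    unfolding f_def[abs_def]
    by (rule C_infinity_on_wave_\<omega>[OF S k _ C_infinity_on_const[OF S]]) (use L in auto)
  have K: "C_infinity_on (\<lambda>p. elliptic_K (fst p)) ?S"
    by (rule C_infinity_on_elliptic_K_compose[OF S k]) auto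
  have F: "C_infinity_on (\<lambda>p. ell_int 0 ((fst p)\<^sup>2, snd p)) ?S"
    by (rule C_infinity_on_compose[OF S C_infinity_on_ell_int _
          C_infinity_on_Pair[OF S C_infinity_on_power[OF S k] x]])
      (auto simp: open_Times abs_square_less_1)
  have g: "C_infinity_on g ?S"
    unfolding g_def[abs_def]
    by (intro C_infinity_on_mult C_infinity_on_divide C_infinity_on_const S K F)
      (auto simp: elliptic_K_pos)
  have gF: "g (k, \<theta>) = L / (4 * elliptic_K k) * elliptic_F \<theta> k" if "k \<in> {0<..<1}" for k \<theta>
    by (simp add: g_def elliptic_F_eq[OF modulus_square_less_1[OF that]])
  show ?thesis
  proof (rule C_infinity_on_planar_inverse[OF S T f g])
    fix p assume p: "p \<in> ?S"
    obtain k \<theta> where k\<theta>: "p = (k, \<theta>)" "k \<in> {0<..<1}" using p by auto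
    note k2 = modulus_square_less_1[OF k\<theta>(2)]
    have "((\<lambda>\<theta>. f (k, \<theta>)) has_real_derivative 0) (at \<theta>)" by (simp add: f_def)
    then have f2: "D2 f p = 0"
      using has_real_derivative_D2[OF f, of k \<theta>] k\<theta> by (auto dest: DERIV_unique)
    have f1: "D1 f p > 0"
      using has_real_derivative_D1[OF f, of k \<theta>] k\<theta> wave_\<omega>_deriv_pos[OF L k\<theta>(2)]
      by (auto simp: f_def dest: DERIV_unique)
    have "((\<lambda>\<theta>. g (k, \<theta>)) has_real_derivative L / (4 * elliptic_K k) * ell_kernel 0 (k\<^sup>2) \<theta>) (at \<theta>)"
      unfolding g_def fst_conv snd_conv by (rule DERIV_cmult[OF ell_int_deriv_\<theta>[OF k2]])
    then have "D2 g p = L / (4 * elliptic_K k) * ell_kernel 0 (k\<^sup>2) \<theta>"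
      using has_real_derivative_D2[OF g, of k \<theta>] k\<theta> by (auto dest: DERIV_unique)
    then have g2: "D2 g p > 0"
      using L elliptic_K_pos[OF k\<theta>(2)] ell_kernel_0_pos[OF k2] by simp
    show "D1 f p * D2 g p - D2 f p * D1 g p > 0"
      unfolding f2 using f1 g2 by simp
    have "4 * elliptic_K k / L * g (k, \<theta>) = elliptic_F \<theta> k"
      using L elliptic_K_pos[OF k\<theta>(2)] by (simp add: gF[OF k\<theta>(2)])
    then show "(case (f p, g p) of (\<omega>, x) \<Rightarrow>
        (modulus_of L \<omega>, jacobi_am (4 * elliptic_K (modulus_of L \<omega>) / L * x) (modulus_of L \<omega>))) = p"
      unfolding k\<theta>(1) prod.case
      by (simp only: f_def fst_conv modulus_of_wave_\<omega>[OF L k\<theta>(2)] jacobi_am_elliptic_F[OF k\<theta>(2)])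
  next
    fix y assume y: "y \<in> {4 * pi\<^sup>2 / L\<^sup>2<..} \<times> (UNIV :: real set)"
    obtain \<omega> x where wx: "y = (\<omega>, x)" "\<omega> > 4 * pi\<^sup>2 / L\<^sup>2" using y by auto
    note m = modulus_of[OF L wx(2)]
    show "(case y of (\<omega>, x) \<Rightarrow>
        (modulus_of L \<omega>, jacobi_am (4 * elliptic_K (modulus_of L \<omega>) / L * x) (modulus_of L \<omega>))) \<in> ?S"
      using m(1) by (simp add: wx(1))
    show "(f (case y of (\<omega>, x) \<Rightarrow>
        (modulus_of L \<omega>, jacobi_am (4 * elliptic_K (modulus_of L \<omega>) / L * x) (modulus_of L \<omega>))),
       g (case y of (\<omega>, x) \<Rightarrow>
        (modulus_of L \<omega>, jacobi_am (4 * elliptic_K (modulus_of L \<omega>) / L * x) (modulus_of L \<omega>)))) = y"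
      using L elliptic_K_pos[OF m(1)]
      unfolding wx(1) prod.case gF[OF m(1)] elliptic_F_jacobi_am[OF m(1)]
      by (simp add: f_def m(2))
  qed
qed

text \<open>
The wave is an explicit smooth function \<open>\<Phi>\<close> of modulus and amplitude, composed with the map of the
previous lemma.
\<close>

lemma smooth_periodic_family_cnoidal_wave:
  assumes c: "\<kappa> + \<gamma> * B ^ 3 > 0" and L: "L > 0"
  shows "smooth_periodic_family L {4 * pi\<^sup>2 / L\<^sup>2<..}
    (\<lambda>(\<omega>, x). cnoidal_wave \<kappa> \<gamma> B L (modulus_of L \<omega>) x)"
  unfolding smooth_periodic_family_def
proof (intro conjI ballI)
  let ?S = "{0<..<1::real} \<times> (UNIV :: real set)"
  let ?T = "{4 * pi\<^sup>2 / L\<^sup>2<..} \<times> (UNIV :: real set)"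
  have S: "open ?S" and T: "open ?T" by (simp_all add: open_Times)
  let ?\<Psi> = "\<lambda>(\<omega>, x). (modulus_of L \<omega>, jacobi_am (4 * elliptic_K (modulus_of L \<omega>) / L * x) (modulus_of L \<omega>))"
  define \<Phi> where "\<Phi> p = 1 / root 4 (\<kappa> + \<gamma> * B ^ 3) *
     (wave_a L (fst p) * cos (snd p) / sqrt (1 - wave_q (fst p) * (sin (snd p))\<^sup>2))" for p
  have k: "C_infinity_on fst ?S"
    by (rule C_infinity_on_fst[OF S C_infinity_on_ident[OF S]])
  have x: "C_infinity_on snd ?S"
    by (rule C_infinity_on_snd[OF S C_infinity_on_ident[OF S]])
  have a: "C_infinity_on (\<lambda>p. wave_a L (fst p)) ?S"
    by (rule C_infinity_on_wave_a[OF S k _ C_infinity_on_const[OF S]]) (use L in auto)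
  have q: "C_infinity_on (\<lambda>p. wave_q (fst p)) ?S"
    by (rule C_infinity_on_wave_q[OF S k]) auto
  have pos: "1 - wave_q (fst p) * (sin (snd p))\<^sup>2 > 0" if "p \<in> ?S" for p
    using wave_q_less[of "fst p"] that by (intro profile_pos) auto
  have "C_infinity_on \<Phi> ?S"
    unfolding \<Phi>_def[abs_def]
    by (intro C_infinity_on_mult C_infinity_on_divide C_infinity_on_sqrt C_infinity_on_diff
        C_infinity_on_power C_infinity_on_sin C_infinity_on_cos C_infinity_on_const S a q x pos)
      (use pos in auto)
  then have "C_infinity_on (\<lambda>y. \<Phi> (?\<Psi> y)) ?T"
    by (rule C_infinity_on_compose[OF T _ S C_infinity_on_modulus_amplitude[OF L]])
      (use modulus_of(1)[OF L] in auto)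
  moreover have "(\<lambda>y. \<Phi> (?\<Psi> y)) = (\<lambda>(\<omega>, x). cnoidal_wave \<kappa> \<gamma> B L (modulus_of L \<omega>) x)"
    by (auto simp: \<Phi>_def cnoidal_wave_def cnoidal_profile_def jacobi_cn_def jacobi_sn_def)
  ultimately show "C_infinity_on (\<lambda>(\<omega>, x). cnoidal_wave \<kappa> \<gamma> B L (modulus_of L \<omega>) x) ?T" by simp
  show "periodic L (\<lambda>x. case (\<omega>, x) of (\<omega>, x) \<Rightarrow> cnoidal_wave \<kappa> \<gamma> B L (modulus_of L \<omega>) x)"
    if "\<omega> \<in> {4 * pi\<^sup>2 / L\<^sup>2<..}" for \<omega>
    using periodic_cnoidal_wave[OF L modulus_of(1)[OF L]] that by simp
qed

theorem proposition2p1: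
  fixes \<kappa> \<gamma> B L :: real
  assumes "\<kappa> > 0" and "\<gamma> \<ge> 0" and "admissible_B \<kappa> \<gamma> B" and "L > 0"
  shows
    "(\<forall>k\<in>{0<..<1}.
        wave_a L k \<in> {2 * sqrt (pi / L)<..} \<and>
        wave_q k \<in> {-2<..<-1} \<and>
        wave_\<omega> L k \<in> {4 * pi\<^sup>2 / L\<^sup>2<..} \<and>
        periodic L (cnoidal_wave \<kappa> \<gamma> B L k) \<and>
        solves_wave_eq \<kappa> \<gamma> B (wave_\<omega> L k) (cnoidal_wave \<kappa> \<gamma> B L k))
     \<and> C_infinity_on (\<lambda>(k, l). wave_a l k) ({0<..<1} \<times> {0<..})
     \<and> C_infinity_on (\<lambda>(k, l :: real). wave_q k) ({0<..<1} \<times> {0<..})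
     \<and> C_infinity_on (\<lambda>(k, l). wave_\<omega> l k) ({0<..<1} \<times> {0<..})
     \<and> (\<forall>\<omega>\<in>{4 * pi\<^sup>2 / L\<^sup>2<..}.
          (\<exists>!k. k \<in> {0<..<1} \<and> wave_\<omega> L k = \<omega>) \<and>
          periodic L (cnoidal_wave \<kappa> \<gamma> B L (modulus_of L \<omega>)) \<and>
          solves_wave_eq \<kappa> \<gamma> B \<omega> (cnoidal_wave \<kappa> \<gamma> B L (modulus_of L \<omega>)))
     \<and> smooth_Hs_curve_on L 2 (\<lambda>\<omega>. cnoidal_wave \<kappa> \<gamma> B L (modulus_of L \<omega>))
         {4 * pi\<^sup>2 / L\<^sup>2<..}"
proof -
  note L = \<open>L > 0\<close>
  have c: "\<kappa> + \<gamma> * B ^ 3 > 0" by (rule admissible_B_coefficient_pos[OF assms(1-3)])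
  let ?R = "{0<..<1::real} \<times> ({0<..} :: real set)"
  have R: "open ?R" by (simp add: open_Times)
  have k: "C_infinity_on fst ?R"
    by (rule C_infinity_on_fst[OF R C_infinity_on_ident[OF R]])
  have l: "C_infinity_on snd ?R"
    by (rule C_infinity_on_snd[OF R C_infinity_on_ident[OF R]])
  show ?thesis
  proof (intro conjI ballI)
    fix k :: real assume k: "k \<in> {0<..<1}"
    show "wave_a L k \<in> {2 * sqrt (pi / L)<..}" using wave_a_gt[OF L k] by simp
    show "wave_q k \<in> {-2<..<-1}" using wave_q_less[OF k] wave_q_greater[OF k] by simp
    show "wave_\<omega> L k \<in> {4 * pi\<^sup>2 / L\<^sup>2<..}" using wave_\<omega>_gt[OF L k] by simp
    show "periodic L (cnoidal_wave \<kappa> \<gamma> B L k)" by (rule periodic_cnoidal_wave[OF L k])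
    show "solves_wave_eq \<kappa> \<gamma> B (wave_\<omega> L k) (cnoidal_wave \<kappa> \<gamma> B L k)"
      by (rule cnoidal_profile_solves[OF c L k])
  next
    show "C_infinity_on (\<lambda>(k, l). wave_a l k) ?R"
      unfolding case_prod_beta' by (rule C_infinity_on_wave_a[OF R k _ l]) auto
    show "C_infinity_on (\<lambda>(k, l :: real). wave_q k) ?R"
      unfolding case_prod_beta' by (rule C_infinity_on_wave_q[OF R k]) auto
    show "C_infinity_on (\<lambda>(k, l). wave_\<omega> l k) ?R"
      unfolding case_prod_beta' by (rule C_infinity_on_wave_\<omega>[OF R k _ l]) auto
  next
    fix \<omega> assume "\<omega> \<in> {4 * pi\<^sup>2 / L\<^sup>2<..}"
    then have \<omega>: "\<omega> > 4 * pi\<^sup>2 / L\<^sup>2" by simp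
    note m = modulus_of[OF L \<omega>]
    show "\<exists>!k. k \<in> {0<..<1} \<and> wave_\<omega> L k = \<omega>" by (rule wave_\<omega>_ex1[OF L \<omega>])
    show "periodic L (cnoidal_wave \<kappa> \<gamma> B L (modulus_of L \<omega>))"
      by (rule periodic_cnoidal_wave[OF L m(1)])
    show "solves_wave_eq \<kappa> \<gamma> B \<omega> (cnoidal_wave \<kappa> \<gamma> B L (modulus_of L \<omega>))"
      using cnoidal_profile_solves[OF c L m(1)] unfolding m(2) .
  next
    show "smooth_Hs_curve_on L 2 (\<lambda>\<omega>. cnoidal_wave \<kappa> \<gamma> B L (modulus_of L \<omega>)) {4 * pi\<^sup>2 / L\<^sup>2<..}"
      using smooth_periodic_family_imp_smooth_Hs_curve[OF L open_greaterThan
          smooth_periodic_family_cnoidal_wave[OF c L]]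
      by simp
  qed
qed

end
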